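(* Let $\hbar,\hbar'>0$, let $\lambda_0,\lambda_1,\mu_1,\varepsilon,\varepsilon'\in\mathbb{R}$ with $\lambda_0\neq0$ and $r,r'\in\mathbb{Z}$ satisfy $\lambda_0\varepsilon+\lambda_1r=-\hbar$, $\lambda_0\varepsilon'+\mu_1r'=\hbar'$, $\lambda_0\varepsilon'+\lambda_1r'=0$, $\lambda_0\varepsilon+\mu_1r=0$, and let $\mathcal{E}_{\hbar,\hbar'}$ be the corresponding $(\mathcal{C}_\hbar^\infty,\mathcal{C}_{\hbar'}^\infty)$-bimodule $\mathcal{S}(\mathbb{R}\times\mathbb{Z})$. Let $\alpha=1/\lambda_0$ and let $\beta,\gamma\in\mathbb{C}$ satisfy $\beta\varepsilon+\gamma r=\beta\varepsilon'+\gamma r'=2\pi i$, so that $$(\nabla_1\xi)(x,k)=\alpha\,\xi'_x(x,k),\qquad(\nabla_2\xi)(x,k)=\beta x\,\xi(x,k)+\gamma k\,\xi(x,k)$$ defines a bimodule connection on $\mathcal{E}_{\hbar,\hbar'}$. Then $\nabla$ has constant curvature depending only on $\hbar$ and $\hbar'$: if $\hbar=\hbar'$ then $(\nabla_1\nabla_2-\nabla_2\nabla_1)\xi=0$, and if $\hbar\neq\hbar'$ then $\hbar/\hbar'\in\mathbb{Q}$ and $$(\nabla_1\nabla_2-\nabla_2\nabla_1)\xi=2\pi i\,\frac{\hbar-\hbar'}{\hbar\hbar'}\,\xi$$ for all $\xi\in\mathcal{E}_{\hbar,\hbar'}$.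
   Context: For $\hbar\in\mathbb{R}$, $\mathcal{C}_\hbar^\infty$ is the space $\mathcal{S}(\mathbb{R}\times S^1)$ of Schwartz functions $f=\sum_nf_n(u)W^n$, $W=e^{2\pi it}$, with product $fg=\sum_{n}\big[\sum_{k}f_k(u)g_{n-k}(u+k\hbar)\big]W^n$ and derivations $\partial_1f=\sum_nf'_n(u)W^n$, $\partial_2f=2\pi i\sum_nnf_n(u)W^n$. The bimodule structure on $\mathcal{S}(\mathbb{R}\times\mathbb{Z})$ (Schwartz functions of one real variable $x$ and one discrete variable $k$) is $(f\xi)(x,k)=\sum_nf_n(\lambda_0x+\lambda_1k)\xi(x-n\varepsilon,k-nr)$ for $f\in\mathcal{C}_\hbar^\infty$ and $(\xi f)(x,k)=\sum_nf_n(\lambda_0x+\mu_1k-n\hbar')\xi(x-n\varepsilon',k-nr')$ for $f\in\mathcal{C}_{\hbar'}^\infty$. A bimodule connection is a pair $\nabla_1,\nabla_2$ with $\nabla_j(f\xi)=f\nabla_j\xi+(\partial_jf)\xi$ for $f\in\mathcal{C}_\hbar^\infty$ and $\nabla_j(\xi f)=(\nabla_j\xi)f+\xi(\partial_jf)$ for $f\in\mathcal{C}_{\hbar'}^\infty$, $j=1,2$. *)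

theory Defs
  imports "HOL-Analysis.Analysis" "HOL-Library.Function_Algebras"
begin

definition partial1 :: "(real \<Rightarrow> 'a \<Rightarrow> complex) \<Rightarrow> real \<Rightarrow> 'a \<Rightarrow> complex" where
  "partial1 f = (\<lambda>x y. vector_derivative (\<lambda>s. f s y) (at x))"

definition partial2 :: "('a \<Rightarrow> real \<Rightarrow> complex) \<Rightarrow> 'a \<Rightarrow> real \<Rightarrow> complex" where
  "partial2 f = (\<lambda>x y. vector_derivative (\<lambda>s. f x s) (at y))"

definition cscale :: "complex \<Rightarrow> ('a \<Rightarrow> 'b \<Rightarrow> complex) \<Rightarrow> 'a \<Rightarrow> 'b \<Rightarrow> complex" where
  "cscale c f = (\<lambda>x y. c * f x y)"

text \<open>Iterated partial derivatives of all orders, taken in any order.\<close>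

inductive_set partials :: "(real \<Rightarrow> real \<Rightarrow> complex) \<Rightarrow> (real \<Rightarrow> real \<Rightarrow> complex) set"
  for f :: "real \<Rightarrow> real \<Rightarrow> complex"
  where
    self: "f \<in> partials f"
  | fst: "g \<in> partials f \<Longrightarrow> partial1 g \<in> partials f"
  | snd: "g \<in> partials f \<Longrightarrow> partial2 g \<in> partials f"

text \<open>
  The Schwartz space of \<open>\<real> \<times> S\<^sup>1\<close>, where \<open>S\<^sup>1 = \<real>/\<int>\<close>: functions on the circle are functions of
  \<open>t\<close> with period 1. It is the underlying space of the algebra for every \<open>h\<close>; only the
  product \<open>hmul h\<close> depends on \<open>h\<close>.
\<close>

definition schwartz_cyl :: "(real \<Rightarrow> real \<Rightarrow> complex) set" where
  "schwartz_cyl = {f.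
     (\<forall>u t. f u (t + 1) = f u t) \<and>
     (\<forall>g\<in>partials f. \<forall>z. (\<lambda>(u, t). g u t) differentiable (at z)) \<and>
     (\<forall>g\<in>partials f. \<forall>p::nat. \<exists>C. \<forall>u t. \<bar>u\<bar> ^ p * norm (g u t) \<le> C)}"

definition W :: "real \<Rightarrow> complex" where
  "W t = exp (2 * of_real pi * \<i> * of_real t)"

definition fcoeff :: "(real \<Rightarrow> real \<Rightarrow> complex) \<Rightarrow> int \<Rightarrow> real \<Rightarrow> complex" where
  "fcoeff f n u = integral {0..1} (\<lambda>t. f u t * W t powi (- n))"

definition hmul :: "real \<Rightarrow> (real \<Rightarrow> real \<Rightarrow> complex) \<Rightarrow> (real \<Rightarrow> real \<Rightarrow> complex) \<Rightarrow>
    real \<Rightarrow> real \<Rightarrow> complex" where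
  "hmul h f g = (\<lambda>u t. \<Sum>\<^sub>\<infinity>n\<in>UNIV.
     (\<Sum>\<^sub>\<infinity>k\<in>UNIV. fcoeff f k u * fcoeff g (n - k) (u + of_int k * h)) * W t powi n)"

definition deriv1 :: "(real \<Rightarrow> real \<Rightarrow> complex) \<Rightarrow> real \<Rightarrow> real \<Rightarrow> complex" where
  "deriv1 f = (\<lambda>u t. \<Sum>\<^sub>\<infinity>n\<in>UNIV. vector_derivative (fcoeff f n) (at u) * W t powi n)"

definition deriv2 :: "(real \<Rightarrow> real \<Rightarrow> complex) \<Rightarrow> real \<Rightarrow> real \<Rightarrow> complex" where
  "deriv2 f = (\<lambda>u t. 2 * of_real pi * \<i> * (\<Sum>\<^sub>\<infinity>n\<in>UNIV. of_int n * fcoeff f n u * W t powi n))"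

definition schwartz_RZ :: "(real \<Rightarrow> int \<Rightarrow> complex) set" where
  "schwartz_RZ = {\<xi>.
     (\<forall>m x k. (\<lambda>y. (partial1 ^^ m) \<xi> y k) differentiable (at x)) \<and>
     (\<forall>m (p::nat) (q::nat). \<exists>C. \<forall>x k.
        \<bar>x\<bar> ^ p * \<bar>real_of_int k\<bar> ^ q * norm ((partial1 ^^ m) \<xi> x k) \<le> C)}"

definition left_act :: "real \<Rightarrow> real \<Rightarrow> real \<Rightarrow> int \<Rightarrow>
    (real \<Rightarrow> real \<Rightarrow> complex) \<Rightarrow> (real \<Rightarrow> int \<Rightarrow> complex) \<Rightarrow> real \<Rightarrow> int \<Rightarrow> complex" where
  "left_act l0 l1 \<epsilon> r f \<xi> = (\<lambda>x k.
     \<Sum>\<^sub>\<infinity>n\<in>UNIV. fcoeff f n (l0 * x + l1 * of_int k) * \<xi> (x - of_int n * \<epsilon>) (k - n * r))"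

definition right_act :: "real \<Rightarrow> real \<Rightarrow> real \<Rightarrow> int \<Rightarrow> real \<Rightarrow>
    (real \<Rightarrow> int \<Rightarrow> complex) \<Rightarrow> (real \<Rightarrow> real \<Rightarrow> complex) \<Rightarrow> real \<Rightarrow> int \<Rightarrow> complex" where
  "right_act l0 m1 \<epsilon>' r' h' \<xi> f = (\<lambda>x k.
     \<Sum>\<^sub>\<infinity>n\<in>UNIV. fcoeff f n (l0 * x + m1 * of_int k - of_int n * h') *
       \<xi> (x - of_int n * \<epsilon>') (k - n * r'))"

definition linear_endo :: "((real \<Rightarrow> int \<Rightarrow> complex) \<Rightarrow> real \<Rightarrow> int \<Rightarrow> complex) \<Rightarrow> bool" where
  "linear_endo D \<longleftrightarrow>
     (\<forall>\<xi>\<in>schwartz_RZ. D \<xi> \<in> schwartz_RZ) \<and>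
     (\<forall>\<xi>\<in>schwartz_RZ. \<forall>\<eta>\<in>schwartz_RZ. D (\<xi> + \<eta>) = D \<xi> + D \<eta>) \<and>
     (\<forall>c. \<forall>\<xi>\<in>schwartz_RZ. D (cscale c \<xi>) = cscale c (D \<xi>))"

text \<open>
  \<open>schwartz_RZ\<close> is a bimodule over \<open>schwartz_cyl\<close> with product \<open>mulA\<close> (acting by \<open>L\<close> on the left) and
  \<open>schwartz_cyl\<close> with product \<open>mulB\<close> (acting by \<open>R\<close> on the right). The algebras have no unit.
\<close>

definition bimodule ::
  "((real \<Rightarrow> real \<Rightarrow> complex) \<Rightarrow> (real \<Rightarrow> real \<Rightarrow> complex) \<Rightarrow> real \<Rightarrow> real \<Rightarrow> complex) \<Rightarrow>
   ((real \<Rightarrow> real \<Rightarrow> complex) \<Rightarrow> (real \<Rightarrow> real \<Rightarrow> complex) \<Rightarrow> real \<Rightarrow> real \<Rightarrow> complex) \<Rightarrow>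
   ((real \<Rightarrow> real \<Rightarrow> complex) \<Rightarrow> (real \<Rightarrow> int \<Rightarrow> complex) \<Rightarrow> real \<Rightarrow> int \<Rightarrow> complex) \<Rightarrow>
   ((real \<Rightarrow> int \<Rightarrow> complex) \<Rightarrow> (real \<Rightarrow> real \<Rightarrow> complex) \<Rightarrow> real \<Rightarrow> int \<Rightarrow> complex) \<Rightarrow> bool" where
  "bimodule mulA mulB L R \<longleftrightarrow>
     (\<forall>f\<in>schwartz_cyl. linear_endo (L f) \<and> linear_endo (\<lambda>\<xi>. R \<xi> f)) \<and>
     (\<forall>f\<in>schwartz_cyl. \<forall>g\<in>schwartz_cyl. \<forall>\<xi>\<in>schwartz_RZ.
        L (f + g) \<xi> = L f \<xi> + L g \<xi> \<and> R \<xi> (f + g) = R \<xi> f + R \<xi> g) \<and>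
     (\<forall>c. \<forall>f\<in>schwartz_cyl. \<forall>\<xi>\<in>schwartz_RZ.
        L (cscale c f) \<xi> = cscale c (L f \<xi>) \<and> R \<xi> (cscale c f) = cscale c (R \<xi> f)) \<and>
     (\<forall>f\<in>schwartz_cyl. \<forall>g\<in>schwartz_cyl. \<forall>\<xi>\<in>schwartz_RZ.
        L (mulA f g) \<xi> = L f (L g \<xi>) \<and>
        R \<xi> (mulB f g) = R (R \<xi> f) g \<and>
        R (L f \<xi>) g = L f (R \<xi> g))"

definition bimodule_connection ::
  "((real \<Rightarrow> real \<Rightarrow> complex) \<Rightarrow> (real \<Rightarrow> int \<Rightarrow> complex) \<Rightarrow> real \<Rightarrow> int \<Rightarrow> complex) \<Rightarrow>
   ((real \<Rightarrow> int \<Rightarrow> complex) \<Rightarrow> (real \<Rightarrow> real \<Rightarrow> complex) \<Rightarrow> real \<Rightarrow> int \<Rightarrow> complex) \<Rightarrow>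
   ((real \<Rightarrow> int \<Rightarrow> complex) \<Rightarrow> real \<Rightarrow> int \<Rightarrow> complex) \<Rightarrow>
   ((real \<Rightarrow> int \<Rightarrow> complex) \<Rightarrow> real \<Rightarrow> int \<Rightarrow> complex) \<Rightarrow> bool" where
  "bimodule_connection L R D1 D2 \<longleftrightarrow>
     linear_endo D1 \<and> linear_endo D2 \<and>
     (\<forall>f\<in>schwartz_cyl. \<forall>\<xi>\<in>schwartz_RZ.
        D1 (L f \<xi>) = L f (D1 \<xi>) + L (deriv1 f) \<xi> \<and>
        D2 (L f \<xi>) = L f (D2 \<xi>) + L (deriv2 f) \<xi> \<and>
        D1 (R \<xi> f) = R (D1 \<xi>) f + R \<xi> (deriv1 f) \<and>
        D2 (R \<xi> f) = R (D2 \<xi>) f + R \<xi> (deriv2 f))"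

definition nabla1 :: "real \<Rightarrow> (real \<Rightarrow> int \<Rightarrow> complex) \<Rightarrow> real \<Rightarrow> int \<Rightarrow> complex" where
  "nabla1 \<alpha> \<xi> = (\<lambda>x k. of_real \<alpha> * partial1 \<xi> x k)"

definition nabla2 ::
  "complex \<Rightarrow> complex \<Rightarrow> (real \<Rightarrow> int \<Rightarrow> complex) \<Rightarrow> real \<Rightarrow> int \<Rightarrow> complex" where
  "nabla2 \<beta> \<gamma> \<xi> = (\<lambda>x k. \<beta> * of_real x * \<xi> x k + \<gamma> * of_int k * \<xi> x k)"

end

(*
  An algebra element acts only through its Fourier coefficients, and these form, as a function of
  (u, n), an element of S(R x Z). So the two actions and the product are all twisted convolutions
  of pairs of elements of S(R x Z), which is closed under them. The module axioms become
  rearrangements of absolutely convergent double series, where the four linear relations between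
  the parameters say how translation in (x, k) shifts the arguments of the coefficients. The Leibniz
  rules are termwise differentiation and the identities beta eps + gamma r = 2 pi i =
  beta eps' + gamma r'. The curvature is alpha beta; eliminating l1, m1, eps, eps', gamma gives
  h r' = h' r with r' nonzero, hence h / h' = r / r', and alpha beta = 2 pi i (h - h') / (h h').
*)
theory Submission
  imports Defs
begin

subsection \<open>Series over the integers\<close>

text \<open>One majorant, \<open>1 / (1 + |n|)^2\<close>, controls every series. Translating
  \<open>(x, k)\<close> by \<open>n\<close> steps costs a polynomial factor in \<open>n\<close> in
  each seminorm, and the rapid decay of the n-th coefficient pays for it, uniformly in the point at
  which the coefficient is evaluated. The affine arguments of the coefficients therefore never enter
  an estimate, only the algebraic identities.

  Product and derivations are given as trigonometric series, so their coefficients are read off by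
  orthogonality of the characters.

  Smoothness needs an induction over pairs: the derivative of a twisted convolution is a sum of two
  others, each with a different factor differentiated.

  The constant comes from the determinant \<open>D = e * r' - e' * r\<close>. Eliminating
  \<open>l1\<close>, respectively \<open>m1\<close>, gives
  \<open>h * r' = - l0 * D = h' * r\<close>, while eliminating \<open>\<gamma>\<close> gives
  \<open>\<beta> * D = 2 pi i (r' - r)\<close>. Dividing,
  \<open>\<beta> / l0 = 2 pi i (r - r') / (h * r')\<close>, and \<open>r / r' = h / h'\<close>
  removes the integers. If \<open>r'\<close> were 0, the two relations for
  \<open>\<epsilon>'\<close> would force \<open>h' = 0\<close>.\<close>

lemma summable_inverse_square_int:
  "(\<lambda>n::int. 1 / (1 + \<bar>real_of_int n\<bar>)\<^sup>2) summable_on UNIV"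
proof -
  let ?M = "\<lambda>n::int. 1 / (1 + \<bar>real_of_int n\<bar>)\<^sup>2"
  have s: "(\<lambda>n::nat. 1 / (1 + real n)\<^sup>2) summable_on UNIV"
  proof (rule norm_summable_imp_summable_on)
    have "summable (\<lambda>n. inverse (real n ^ 2))"
      by (rule inverse_power_summable) simp
    then have "summable (\<lambda>n. inverse (real (Suc n) ^ 2))"
      by (subst summable_Suc_iff)
    then show "summable (\<lambda>n. norm (1 / (1 + real n)\<^sup>2))"
      by (simp add: inverse_eq_divide)
  qed
  have "?M summable_on range int"
    by (subst summable_on_reindex) (use s in \<open>auto simp: o_def\<close>)
  \<comment> \<open>The offset 1 makes this range exactly the negative integers, hence disjoint from
    \<open>range int\<close>; the n-th term becomes \<open>1 / (2 + n)^2\<close>.\<close>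
  moreover have "?M summable_on range (\<lambda>n. - int n - 1)"
  proof (subst summable_on_reindex)
    show "inj (\<lambda>n. - int n - 1)" by (auto simp: inj_def)
    have "(\<lambda>n::nat. norm (?M (- int n - 1))) summable_on UNIV"
    proof (rule Infinite_Sum.abs_summable_on_comparison_test'[OF s])
      fix n :: nat
      show "norm (?M (- int n - 1)) \<le> 1 / (1 + real n)\<^sup>2"
        by (simp add: frac_le power_mono)
    qed
    then show "(?M \<circ> (\<lambda>n. - int n - 1)) summable_on UNIV"
      by (simp add: o_def)
  qed
  ultimately have "?M summable_on (range int \<union> range (\<lambda>n. - int n - 1))"
    by (intro summable_on_Un_disjoint) auto
  moreover have "range int \<union> range (\<lambda>n. - int n - 1) = UNIV"
  proof -
    have "k \<in> range int \<union> range (\<lambda>n. - int n - 1)" for k :: int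
    proof (cases "k \<ge> 0")
      case True
      then have "k = int (nat k)" by simp
      then show ?thesis by blast
    next
      case False
      then have "k = - int (nat (- k - 1)) - 1" by simp
      then show ?thesis by blast
    qed
    then show ?thesis by blast
  qed
  ultimately show ?thesis by simp
qed

text \<open>Termwise differentiation concerns sequences of partial sums, so unordered sums are
  enumerated along \<open>int_decode\<close>; absolute convergence makes the enumeration
  irrelevant.\<close>

lemma sums_infsum_int:
  fixes f :: "int \<Rightarrow> complex"
  assumes "\<And>n. norm (f n) \<le> M n" and "M summable_on UNIV"
  shows "(\<lambda>n. f (int_decode n)) sums (\<Sum>\<^sub>\<infinity>n. f n)"
proof -
  have "(\<lambda>n. norm (f n)) summable_on UNIV"
    by (rule Infinite_Sum.abs_summable_on_comparison_test'[OF assms(2)]) (rule assms)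
  then have "f summable_on UNIV" by (rule Infinite_Sum.abs_summable_summable)
  then have "(f has_sum (\<Sum>\<^sub>\<infinity>n. f n)) UNIV" by simp
  then have "((\<lambda>n. f (int_decode n)) has_sum (\<Sum>\<^sub>\<infinity>n. f n)) UNIV"
    using has_sum_reindex_bij_betw[OF bij_int_decode] by blast
  then show ?thesis by (rule has_sum_imp_sums)
qed

text \<open>By the Weierstrass M-test the series of derivatives converges uniformly on the whole
  line, which together with convergence of the original series permits termwise
  differentiation.\<close>

lemma has_vector_derivative_infsum:
  fixes f f' :: "int \<Rightarrow> real \<Rightarrow> complex"
  assumes d: "\<And>n x. (f n has_vector_derivative f' n x) (at x)"
    and b: "\<And>n x. norm (f n x) \<le> M n" and b': "\<And>n x. norm (f' n x) \<le> M' n"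
    and M: "M summable_on UNIV" and M': "M' summable_on UNIV"
  shows "((\<lambda>x. \<Sum>\<^sub>\<infinity>n. f n x) has_vector_derivative (\<Sum>\<^sub>\<infinity>n. f' n x)) (at x)"
proof -
  let ?F = "\<lambda>n. f (int_decode n)" and ?F' = "\<lambda>n. f' (int_decode n)"
  let ?g' = "\<lambda>x. \<Sum>\<^sub>\<infinity>n. f' n x"
  have S: "(\<lambda>n. ?F n x) sums (\<Sum>\<^sub>\<infinity>n. f n x)" for x
    by (rule sums_infsum_int[OF b M])
  have S': "(\<lambda>n. ?F' n x) sums ?g' x" for x
    by (rule sums_infsum_int[OF b' M'])
  have "(\<lambda>n. M' (int_decode n)) summable_on UNIV"
    by (subst summable_on_reindex_bij_betw[OF bij_int_decode]) (rule M')
  then have "summable (\<lambda>n. M' (int_decode n))"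
    by (rule summable_on_imp_summable)
  then have "uniform_limit UNIV (\<lambda>n x. \<Sum>i<n. ?F' i x) (\<lambda>x. suminf (\<lambda>i. ?F' i x)) sequentially"
    by (intro Weierstrass_m_test) (auto intro: b')
  moreover have "suminf (\<lambda>i. ?F' i x) = ?g' x" for x
    using S' by (simp add: sums_iff)
  ultimately have u: "uniform_limit UNIV (\<lambda>n x. \<Sum>i<n. ?F' i x) ?g' sequentially"
    by simp
  have "\<exists>g. \<forall>x\<in>UNIV. (\<lambda>n. ?F n x) sums g x \<and>
      (g has_derivative (\<lambda>h. h *\<^sub>R ?g' x)) (at x within UNIV)"
  proof (rule has_derivative_series[OF convex_UNIV, where f' = "\<lambda>n x h. h *\<^sub>R ?F' n x"])
    show "(?F n has_derivative (\<lambda>h. h *\<^sub>R ?F' n x)) (at x within UNIV)" for n x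
      using d[of "int_decode n" x] by (simp add: has_vector_derivative_def)
    show "\<forall>\<^sub>F n in sequentially. \<forall>x\<in>UNIV. \<forall>h.
        norm ((\<Sum>i<n. h *\<^sub>R ?F' i x) - h *\<^sub>R ?g' x) \<le> e * norm h" if "e > 0" for e
      using uniform_limitD[OF u that]
    proof eventually_elim
      case (elim n)
      show ?case
      proof (intro ballI allI)
        fix x h :: real
        have "norm ((\<Sum>i<n. h *\<^sub>R ?F' i x) - h *\<^sub>R ?g' x)
          = \<bar>h\<bar> * norm ((\<Sum>i<n. ?F' i x) - ?g' x)"
          by (simp flip: scaleR_sum_right scaleR_diff_right)
        also have "\<dots> \<le> \<bar>h\<bar> * e"
          using elim[rule_format, of x] by (intro mult_left_mono) (auto simp: dist_norm)
        finally show "norm ((\<Sum>i<n. h *\<^sub>R ?F' i x) - h *\<^sub>R ?g' x) \<le> e * norm h"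
          by (simp add: mult.commute)
      qed
    qed
    show "(\<lambda>n. ?F n 0) sums (\<Sum>\<^sub>\<infinity>n. f n 0)" by (rule S)
  qed simp
  then obtain g where g: "\<And>x. (\<lambda>n. ?F n x) sums g x"
      "\<And>x. (g has_derivative (\<lambda>h. h *\<^sub>R ?g' x)) (at x)"
    by auto
  \<comment> \<open>The series theorem only provides some limit function; uniqueness of limits
    identifies it with the unordered sum.\<close>
  have "g = (\<lambda>x. \<Sum>\<^sub>\<infinity>n. f n x)"
    using g(1) S sums_unique2 by blast
  with g(2) show ?thesis by (simp add: has_vector_derivative_def)
qed

text \<open>Fubini for sums: a product of two inverse squares is summable over pairs of integers.
  The convolution form is what composing two actions produces, the swap is what exchanging them
  produces.\<close>

lemma
  fixes F :: "int \<Rightarrow> int \<Rightarrow> complex"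
  assumes F: "\<And>j m. norm (F j m) \<le> C / ((1 + \<bar>real_of_int j\<bar>)\<^sup>2 * (1 + \<bar>real_of_int m\<bar>)\<^sup>2)"
  shows infsum_int_swap: "(\<Sum>\<^sub>\<infinity>j. \<Sum>\<^sub>\<infinity>m. F j m) = (\<Sum>\<^sub>\<infinity>m. \<Sum>\<^sub>\<infinity>j. F j m)"
    and infsum_int_convolution: "(\<Sum>\<^sub>\<infinity>n. \<Sum>\<^sub>\<infinity>j. F j (n - j)) = (\<Sum>\<^sub>\<infinity>j. \<Sum>\<^sub>\<infinity>m. F j m)"
proof -
  let ?M = "\<lambda>n::int. 1 / (1 + \<bar>real_of_int n\<bar>)\<^sup>2"
  have MM: "(\<lambda>z. norm (case z of (j, m) \<Rightarrow> ?M j * ?M m)) summable_on UNIV \<times> UNIV"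
    unfolding Infinite_Sum.abs_summable_on_Sigma_iff
  proof (intro conjI ballI)
    show "(\<lambda>m. norm (case (j, m) of (j, m) \<Rightarrow> ?M j * ?M m)) summable_on UNIV" for j
      using summable_on_cmult_right[OF summable_inverse_square_int, of "?M j"] by simp
    have eq: "norm (\<Sum>\<^sub>\<infinity>m. norm (case (j, m) of (j, m) \<Rightarrow> ?M j * ?M m))
        = ?M j * (\<Sum>\<^sub>\<infinity>m. ?M m)" for j
    proof -
      have "(\<Sum>\<^sub>\<infinity>m. norm (case (j, m) of (j, m) \<Rightarrow> ?M j * ?M m)) = (\<Sum>\<^sub>\<infinity>m. ?M j * ?M m)"
        by (intro infsum_cong) (simp add: abs_mult)
      also have "\<dots> = ?M j * (\<Sum>\<^sub>\<infinity>m. ?M m)" by (rule infsum_cmult_right')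
      moreover have "(\<Sum>\<^sub>\<infinity>m. ?M m) \<ge> 0" by (rule infsum_nonneg) simp
      ultimately show ?thesis by (simp only: real_norm_def abs_mult abs_of_nonneg) simp
    qed
    show "(\<lambda>j. norm (\<Sum>\<^sub>\<infinity>m. norm (case (j, m) of (j, m) \<Rightarrow> ?M j * ?M m))) summable_on UNIV"
      unfolding eq by (rule summable_on_cmult_left[OF summable_inverse_square_int])
  qed
  then have "(\<lambda>z. C * (case z of (j, m) \<Rightarrow> ?M j * ?M m)) summable_on UNIV \<times> UNIV"
    by (intro summable_on_cmult_right) (rule iffD2[OF summable_on_iff_abs_summable_on_real])
  then have "(\<lambda>z. norm (case z of (j, m) \<Rightarrow> F j m)) summable_on UNIV \<times> UNIV"
    by (rule Infinite_Sum.abs_summable_on_comparison_test') (use F in auto)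
  then have s: "(\<lambda>(j, m). F j m) summable_on UNIV \<times> UNIV"
    by (rule Infinite_Sum.abs_summable_summable)
  show swap: "(\<Sum>\<^sub>\<infinity>j. \<Sum>\<^sub>\<infinity>m. F j m) = (\<Sum>\<^sub>\<infinity>m. \<Sum>\<^sub>\<infinity>j. F j m)"
    by (rule infsum_swap_banach[OF s])
  \<comment> \<open>A shear of the integer lattice transports summability to the convolution
    indexing.\<close>
  have bij: "bij (\<lambda>(n, j). (j, n - j :: int))"
    by (rule bij_betwI[where g = "\<lambda>(j, m). (j + m, j)"]) auto
  have "(\<lambda>(n, j). F j (n - j)) summable_on UNIV \<times> UNIV"
    using iffD2[OF summable_on_reindex_bij_betw[OF bij] s[unfolded UNIV_Times_UNIV]]
    unfolding UNIV_Times_UNIV by (simp only: case_prod_unfold fst_conv snd_conv)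
  then have "(\<Sum>\<^sub>\<infinity>n. \<Sum>\<^sub>\<infinity>j. F j (n - j)) = (\<Sum>\<^sub>\<infinity>j. \<Sum>\<^sub>\<infinity>n. F j (n - j))"
    by (rule infsum_swap_banach)
  also have "\<dots> = (\<Sum>\<^sub>\<infinity>j. \<Sum>\<^sub>\<infinity>m. F j m)"
  proof (rule infsum_cong)
    fix j :: int
    have "bij (\<lambda>n. n - j)" by (rule bij_betwI[where g = "\<lambda>n. n + j"]) auto
    then show "(\<Sum>\<^sub>\<infinity>n. F j (n - j)) = (\<Sum>\<^sub>\<infinity>m. F j m)"
      by (rule infsum_reindex_bij_betw)
  qed
  finally show "(\<Sum>\<^sub>\<infinity>n. \<Sum>\<^sub>\<infinity>j. F j (n - j)) = (\<Sum>\<^sub>\<infinity>j. \<Sum>\<^sub>\<infinity>m. F j m)" .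
qed

subsection \<open>The Schwartz space in a real and an integer variable\<close>

text \<open>The weight is at least 1 everywhere, and translation multiplies it by at most a
  polynomial in the shift. The monomials \<open>|x|^p * |k|^q\<close> have neither property, since
  they vanish on the axes.\<close>

definition rapid :: "(real \<Rightarrow> int \<Rightarrow> complex) \<Rightarrow> bool" where
  "rapid \<xi> \<longleftrightarrow>
     (\<forall>p. \<exists>C. \<forall>x k. ((1 + \<bar>x\<bar>) * (1 + \<bar>real_of_int k\<bar>)) ^ p * norm (\<xi> x k) \<le> C)"

lemma rapidE:
  assumes "rapid \<xi>"
  obtains C where "C \<ge> 0"
    "\<And>x k. ((1 + \<bar>x\<bar>) * (1 + \<bar>real_of_int k\<bar>)) ^ p * norm (\<xi> x k) \<le> C"
proof -
  obtain C where C: "\<And>x k. ((1 + \<bar>x\<bar>) * (1 + \<bar>real_of_int k\<bar>)) ^ p * norm (\<xi> x k) \<le> C"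
    using assms unfolding rapid_def by blast
  have "0 \<le> ((1 + \<bar>0\<bar>) * (1 + \<bar>real_of_int 0\<bar>)) ^ p * norm (\<xi> 0 0)" by simp
  also have "\<dots> \<le> C" by (rule C)
  finally show ?thesis using C that by blast
qed

lemma rapid_bound:
  assumes "rapid c"
  obtains C where "C \<ge> 0" "\<And>u n. norm (c u n) \<le> C / (1 + \<bar>real_of_int n\<bar>)\<^sup>2"
    "\<And>u n. norm (c u n) \<le> C"
proof -
  obtain C where C: "C \<ge> 0"
      "\<And>x k. ((1 + \<bar>x\<bar>) * (1 + \<bar>real_of_int k\<bar>)) ^ 2 * norm (c x k) \<le> C"
    using rapidE[OF assms] by metis
  have "norm (c u n) * (1 + \<bar>real_of_int n\<bar>)\<^sup>2 \<le> C" for u n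
  proof -
    have "(1 + \<bar>real_of_int n\<bar>) ^ 2 * norm (c u n)
        \<le> ((1 + \<bar>u\<bar>) * (1 + \<bar>real_of_int n\<bar>)) ^ 2 * norm (c u n)"
      by (intro mult_right_mono power_mono) (auto simp: distrib_right)
    also have "\<dots> \<le> C" by (rule C)
    finally show ?thesis by (simp only: mult.commute)
  qed
  then have 1: "norm (c u n) \<le> C / (1 + \<bar>real_of_int n\<bar>)\<^sup>2" for u n
    by (subst pos_le_divide_eq) auto
  moreover have "C / (1 + \<bar>real_of_int n\<bar>)\<^sup>2 \<le> C / 1" for n
    using C(1) by (intro divide_left_mono) (auto simp: one_le_power)
  ultimately show ?thesis
    using that[OF C(1)] order_trans by (metis div_by_1)
qed

lemma power_one_plus_le:
  fixes a :: real
  assumes "a \<ge> 0"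
  shows "(1 + a) ^ p \<le> 2 ^ p * (1 + a ^ p)"
proof (cases "a \<le> 1")
  case True
  then have "(1 + a) ^ p \<le> 2 ^ p * 1" using assms by (simp add: power_mono)
  also have "\<dots> \<le> 2 ^ p * (1 + a ^ p)" using assms by (intro mult_left_mono) auto
  finally show ?thesis .
next
  case False
  then have "(1 + a) ^ p \<le> (2 * a) ^ p" by (intro power_mono) auto
  also have "\<dots> \<le> 2 ^ p * (1 + a ^ p)" by (simp add: power_mult_distrib)
  finally show ?thesis .
qed

lemma rapid_iff:
  "rapid \<xi> \<longleftrightarrow>
     (\<forall>p q. \<exists>C. \<forall>x k. \<bar>x\<bar> ^ p * \<bar>real_of_int k\<bar> ^ q * norm (\<xi> x k) \<le> C)"
proof
  assume r: "rapid \<xi>"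
  show "\<forall>p q. \<exists>C. \<forall>x k. \<bar>x\<bar> ^ p * \<bar>real_of_int k\<bar> ^ q * norm (\<xi> x k) \<le> C"
  proof (intro allI)
    fix p q
    \<comment> \<open>Both weight factors are at least 1, so the exponent \<open>p + q\<close>
      dominates \<open>p\<close> in one variable and \<open>q\<close> in the other.\<close>
    obtain C where C: "\<And>x k. ((1 + \<bar>x\<bar>) * (1 + \<bar>real_of_int k\<bar>)) ^ (p + q) * norm (\<xi> x k) \<le> C"
      using rapidE[OF r] by metis
    have "\<bar>x\<bar> ^ p * \<bar>real_of_int k\<bar> ^ q * norm (\<xi> x k) \<le> C" for x k
    proof -
      have "\<bar>x\<bar> ^ p \<le> (1 + \<bar>x\<bar>) ^ (p + q)"
        by (rule order_trans[OF power_mono[of _ "1 + \<bar>x\<bar>"] power_increasing]) auto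
      moreover have "\<bar>real_of_int k\<bar> ^ q \<le> (1 + \<bar>real_of_int k\<bar>) ^ (p + q)"
        by (rule order_trans[OF power_mono[of _ "1 + \<bar>real_of_int k\<bar>"] power_increasing]) auto
      ultimately have "\<bar>x\<bar> ^ p * \<bar>real_of_int k\<bar> ^ q
          \<le> ((1 + \<bar>x\<bar>) * (1 + \<bar>real_of_int k\<bar>)) ^ (p + q)"
        unfolding power_mult_distrib by (intro mult_mono) auto
      then show ?thesis
        using C[of x k] by (meson mult_right_mono norm_ge_zero order_trans)
    qed
    then show "\<exists>C. \<forall>x k. \<bar>x\<bar> ^ p * \<bar>real_of_int k\<bar> ^ q * norm (\<xi> x k) \<le> C" by blast
  qed
next
  assume *: "\<forall>p q. \<exists>C. \<forall>x k. \<bar>x\<bar> ^ p * \<bar>real_of_int k\<bar> ^ q * norm (\<xi> x k) \<le> C"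
  show "rapid \<xi>" unfolding rapid_def
  proof
    fix p
    obtain C where C: "\<And>q r x k. \<bar>x\<bar> ^ q * \<bar>real_of_int k\<bar> ^ r * norm (\<xi> x k) \<le> C q r"
      using * by metis
    \<comment> \<open>Expanding \<open>(1 + |x|^p) * (1 + |k|^p)\<close> yields four monomials,
      hence four constants; \<open>4 ^ p\<close> collects one \<open>2 ^ p\<close> from each
      variable.\<close>
    have "((1 + \<bar>x\<bar>) * (1 + \<bar>real_of_int k\<bar>)) ^ p * norm (\<xi> x k)
        \<le> 4 ^ p * (C 0 0 + C p 0 + C 0 p + C p p)" for x k
    proof -
      have "((1 + \<bar>x\<bar>) * (1 + \<bar>real_of_int k\<bar>)) ^ p
          \<le> (2 ^ p * (1 + \<bar>x\<bar> ^ p)) * (2 ^ p * (1 + \<bar>real_of_int k\<bar> ^ p))"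
        unfolding power_mult_distrib by (intro mult_mono power_one_plus_le) auto
      also have "\<dots> = 4 ^ p * ((1 + \<bar>x\<bar> ^ p) * (1 + \<bar>real_of_int k\<bar> ^ p))"
        by (simp flip: power_mult_distrib)
      finally have "((1 + \<bar>x\<bar>) * (1 + \<bar>real_of_int k\<bar>)) ^ p * norm (\<xi> x k)
          \<le> 4 ^ p * ((1 + \<bar>x\<bar> ^ p) * (1 + \<bar>real_of_int k\<bar> ^ p)) * norm (\<xi> x k)"
        by (intro mult_right_mono) auto
      also have "\<dots> = 4 ^ p * (\<bar>x\<bar> ^ 0 * \<bar>real_of_int k\<bar> ^ 0 * norm (\<xi> x k)
          + \<bar>x\<bar> ^ p * \<bar>real_of_int k\<bar> ^ 0 * norm (\<xi> x k)
          + \<bar>x\<bar> ^ 0 * \<bar>real_of_int k\<bar> ^ p * norm (\<xi> x k)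
          + \<bar>x\<bar> ^ p * \<bar>real_of_int k\<bar> ^ p * norm (\<xi> x k))"
        by (simp add: algebra_simps)
      also have "\<dots> \<le> 4 ^ p * (C 0 0 + C p 0 + C 0 p + C p p)"
        by (intro mult_left_mono add_mono C) simp
      finally show ?thesis .
    qed
    then show "\<exists>C. \<forall>x k. ((1 + \<bar>x\<bar>) * (1 + \<bar>real_of_int k\<bar>)) ^ p * norm (\<xi> x k) \<le> C" by blast
  qed
qed

section \<open>Operations preserving rapid decay\<close>

lemma rapid_add: "rapid \<xi> \<Longrightarrow> rapid \<eta> \<Longrightarrow> rapid (\<xi> + \<eta>)"
  unfolding rapid_def
proof
  fix p
  assume "\<forall>p. \<exists>C. \<forall>x k. ((1 + \<bar>x\<bar>) * (1 + \<bar>real_of_int k\<bar>)) ^ p * norm (\<xi> x k) \<le> C"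
    and "\<forall>p. \<exists>C. \<forall>x k. ((1 + \<bar>x\<bar>) * (1 + \<bar>real_of_int k\<bar>)) ^ p * norm (\<eta> x k) \<le> C"
  then obtain C D where
    C: "\<And>x k. ((1 + \<bar>x\<bar>) * (1 + \<bar>real_of_int k\<bar>)) ^ p * norm (\<xi> x k) \<le> C" and
    D: "\<And>x k. ((1 + \<bar>x\<bar>) * (1 + \<bar>real_of_int k\<bar>)) ^ p * norm (\<eta> x k) \<le> D"
    by metis
  have "((1 + \<bar>x\<bar>) * (1 + \<bar>real_of_int k\<bar>)) ^ p * norm ((\<xi> + \<eta>) x k) \<le> C + D" for x k
  proof -
    have "((1 + \<bar>x\<bar>) * (1 + \<bar>real_of_int k\<bar>)) ^ p * norm ((\<xi> + \<eta>) x k)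
        \<le> ((1 + \<bar>x\<bar>) * (1 + \<bar>real_of_int k\<bar>)) ^ p * (norm (\<xi> x k) + norm (\<eta> x k))"
      by (intro mult_left_mono) (auto simp: norm_triangle_ineq)
    also have "\<dots> \<le> C + D" using C[of x k] D[of x k] by (simp only: distrib_left add_mono)
    finally show ?thesis .
  qed
  then show "\<exists>C. \<forall>x k. ((1 + \<bar>x\<bar>) * (1 + \<bar>real_of_int k\<bar>)) ^ p * norm ((\<xi> + \<eta>) x k) \<le> C"
    by blast
qed

text \<open>One further power of the weight absorbs the extra factor. This covers scalar multiples
  as well as multiplication by \<open>x\<close> and \<open>k\<close>.\<close>

lemma rapid_dominated:
  assumes \<xi>: "rapid \<xi>" and A: "A \<ge> 0"
    and le: "\<And>x k. norm (\<eta> x k) \<le> A * ((1 + \<bar>x\<bar>) * (1 + \<bar>real_of_int k\<bar>)) * norm (\<xi> x k)"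
  shows "rapid \<eta>"
  unfolding rapid_def
proof
  fix p
  obtain C where C: "\<And>x k. ((1 + \<bar>x\<bar>) * (1 + \<bar>real_of_int k\<bar>)) ^ Suc p * norm (\<xi> x k) \<le> C"
    using rapidE[OF \<xi>] by metis
  have "((1 + \<bar>x\<bar>) * (1 + \<bar>real_of_int k\<bar>)) ^ p * norm (\<eta> x k) \<le> A * C" for x k
  proof -
    have "((1 + \<bar>x\<bar>) * (1 + \<bar>real_of_int k\<bar>)) ^ p * norm (\<eta> x k)
      \<le> ((1 + \<bar>x\<bar>) * (1 + \<bar>real_of_int k\<bar>)) ^ p *
        (A * ((1 + \<bar>x\<bar>) * (1 + \<bar>real_of_int k\<bar>)) * norm (\<xi> x k))"
      by (intro mult_left_mono le) auto
    also have "\<dots> = A * (((1 + \<bar>x\<bar>) * (1 + \<bar>real_of_int k\<bar>)) ^ Suc p * norm (\<xi> x k))"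
      by simp
    also have "\<dots> \<le> A * C" by (intro mult_left_mono C A)
    finally show ?thesis .
  qed
  then show "\<exists>C. \<forall>x k. ((1 + \<bar>x\<bar>) * (1 + \<bar>real_of_int k\<bar>)) ^ p * norm (\<eta> x k) \<le> C" by blast
qed

lemma rapid_cscale:
  assumes "rapid \<xi>"
  shows "rapid (cscale c \<xi>)"
proof (rule rapid_dominated[OF assms norm_ge_zero])
  fix x k
  have "1 \<le> (1 + \<bar>x\<bar>) * (1 + \<bar>real_of_int k\<bar>)"
    using mult_mono[of 1 "1 + \<bar>x\<bar>" 1 "1 + \<bar>real_of_int k\<bar>"] by simp
  then have "norm c * 1 * norm (\<xi> x k)
      \<le> norm c * ((1 + \<bar>x\<bar>) * (1 + \<bar>real_of_int k\<bar>)) * norm (\<xi> x k)"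
    by (intro mult_right_mono mult_left_mono) auto
  then show "norm (cscale c \<xi> x k)
      \<le> norm c * ((1 + \<bar>x\<bar>) * (1 + \<bar>real_of_int k\<bar>)) * norm (\<xi> x k)"
    by (simp add: cscale_def norm_mult)
qed

lemma rapid_nabla2:
  assumes "rapid \<xi>"
  shows "rapid (nabla2 \<beta> \<gamma> \<xi>)"
proof (rule rapid_dominated[OF assms, of "norm \<beta> + norm \<gamma>"])
  fix x k
  have x: "\<bar>x\<bar> \<le> (1 + \<bar>x\<bar>) * (1 + \<bar>real_of_int k\<bar>)"
    and k: "\<bar>real_of_int k\<bar> \<le> (1 + \<bar>x\<bar>) * (1 + \<bar>real_of_int k\<bar>)"
    by (auto simp: distrib_left distrib_right)
  have "norm (nabla2 \<beta> \<gamma> \<xi> x k)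
      \<le> norm (\<beta> * of_real x * \<xi> x k) + norm (\<gamma> * of_int k * \<xi> x k)"
    unfolding nabla2_def by (rule norm_triangle_ineq)
  also have "\<dots> = (norm \<beta> * \<bar>x\<bar> + norm \<gamma> * \<bar>real_of_int k\<bar>) * norm (\<xi> x k)"
    by (simp add: norm_mult distrib_right)
  also have "\<dots> \<le> (norm \<beta> * ((1 + \<bar>x\<bar>) * (1 + \<bar>real_of_int k\<bar>))
      + norm \<gamma> * ((1 + \<bar>x\<bar>) * (1 + \<bar>real_of_int k\<bar>))) * norm (\<xi> x k)"
    by (intro mult_right_mono add_mono mult_left_mono x k) auto
  finally show "norm (nabla2 \<beta> \<gamma> \<xi> x k)
      \<le> (norm \<beta> + norm \<gamma>) * ((1 + \<bar>x\<bar>) * (1 + \<bar>real_of_int k\<bar>)) * norm (\<xi> x k)"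
    by (simp add: distrib_right)
qed simp

section \<open>Smoothness, one derivative at a time\<close>

primrec schwartz_level :: "nat \<Rightarrow> (real \<Rightarrow> int \<Rightarrow> complex) \<Rightarrow> bool" where
  "schwartz_level 0 \<xi> \<longleftrightarrow> (\<forall>x k. (\<lambda>y. \<xi> y k) differentiable (at x)) \<and> rapid \<xi>"
| "schwartz_level (Suc m) \<xi> \<longleftrightarrow> (\<forall>x k. (\<lambda>y. \<xi> y k) differentiable (at x)) \<and> rapid \<xi> \<and>
     schwartz_level m (partial1 \<xi>)"

lemma schwartz_level_iff:
  "schwartz_level m \<xi> \<longleftrightarrow>
     (\<forall>j\<le>m. (\<forall>x k. (\<lambda>y. (partial1 ^^ j) \<xi> y k) differentiable (at x)) \<and> rapid ((partial1 ^^ j) \<xi>))"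
proof (induction m arbitrary: \<xi>)
  case (Suc m)
  have "(\<forall>j\<le>Suc m. P j) \<longleftrightarrow> P 0 \<and> (\<forall>j\<le>m. P (Suc j))" for P :: "nat \<Rightarrow> bool"
    by (metis Suc_le_mono not0_implies_Suc zero_le)
  from this[of "\<lambda>j. (\<forall>x k. (\<lambda>y. (partial1 ^^ j) \<xi> y k) differentiable (at x)) \<and> rapid ((partial1 ^^ j) \<xi>)"]
  show ?case
    unfolding schwartz_level.simps Suc.IH by (simp add: funpow_swap1)
qed simp

lemma schwartz_RZ_iff: "\<xi> \<in> schwartz_RZ \<longleftrightarrow> (\<forall>m. schwartz_level m \<xi>)"
  unfolding schwartz_level_iff schwartz_RZ_def rapid_iff by blast

lemma schwartz_level_0: "schwartz_level m \<xi> \<Longrightarrow> schwartz_level 0 \<xi>"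
  by (cases m) auto

lemma schwartz_RZ_level: "\<xi> \<in> schwartz_RZ \<Longrightarrow> schwartz_level m \<xi>"
  by (simp add: schwartz_RZ_iff)

lemma schwartz_RZ_rapid: "\<xi> \<in> schwartz_RZ \<Longrightarrow> rapid \<xi>"
  using schwartz_RZ_level[of \<xi> 0] by simp

lemma partial1_eqI:
  "(\<And>x y. ((\<lambda>s. \<xi> s y) has_vector_derivative \<eta> x y) (at x)) \<Longrightarrow> partial1 \<xi> = \<eta>"
  unfolding partial1_def by (intro ext vector_derivative_at)

lemma schwartz_level_derivative:
  assumes "schwartz_level m \<xi>"
  shows "((\<lambda>y. \<xi> y k) has_vector_derivative partial1 \<xi> x k) (at x)"
  using schwartz_level_0[OF assms] by (simp add: partial1_def flip: vector_derivative_works)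

lemma schwartz_RZ_derivative:
  "\<xi> \<in> schwartz_RZ \<Longrightarrow> ((\<lambda>y. \<xi> y k) has_vector_derivative partial1 \<xi> x k) (at x)"
  by (rule schwartz_level_derivative[OF schwartz_RZ_level[where m = 0]])

lemma schwartz_RZ_partial1: "\<xi> \<in> schwartz_RZ \<Longrightarrow> partial1 \<xi> \<in> schwartz_RZ"
  unfolding schwartz_RZ_iff using schwartz_level.simps(2) by blast

text \<open>The common step of all closure proofs: a formula for the first derivative suffices,
  because iterated derivatives are handled by the induction on \<open>m\<close>. The last premise is
  vacuous for \<open>m = 0\<close>, so base case and step are treated together.\<close>

lemma schwartz_levelI:
  assumes "\<And>x k. ((\<lambda>y. \<xi> y k) has_vector_derivative \<eta> x k) (at x)" "rapid \<xi>"
    and "\<And>j. m = Suc j \<Longrightarrow> schwartz_level j \<eta>"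
  shows "schwartz_level m \<xi>"
  using assms partial1_eqI[of \<xi> \<eta>]
  by (cases m) (auto simp: differentiable_def has_vector_derivative_def)

lemma schwartz_level_rapid: "schwartz_level m \<xi> \<Longrightarrow> rapid \<xi>"
  using schwartz_level_0 by auto

lemma schwartz_level_partial1: "schwartz_level (Suc m) \<xi> \<Longrightarrow> schwartz_level m (partial1 \<xi>)"
  by simp

lemma schwartz_level_mono: "schwartz_level m \<xi> \<Longrightarrow> j \<le> m \<Longrightarrow> schwartz_level j \<xi>"
  by (simp add: schwartz_level_iff)

lemma schwartz_level_add:
  "schwartz_level m \<xi> \<Longrightarrow> schwartz_level m \<eta> \<Longrightarrow> schwartz_level m (\<xi> + \<eta>)"
proof (induction m arbitrary: \<xi> \<eta> rule: less_induct)
  case (less m)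
  show ?case
  proof (rule schwartz_levelI)
    show "((\<lambda>y. (\<xi> + \<eta>) y k) has_vector_derivative (partial1 \<xi> + partial1 \<eta>) x k) (at x)" for x k
      using less.prems
      by (auto intro!: has_vector_derivative_add schwartz_level_derivative)
    show "rapid (\<xi> + \<eta>)"
      using less.prems by (intro rapid_add schwartz_level_rapid)
    show "schwartz_level j (partial1 \<xi> + partial1 \<eta>)" if "m = Suc j" for j
      using less.prems that by (intro less.IH) auto
  qed
qed

lemma schwartz_level_cscale: "schwartz_level m \<xi> \<Longrightarrow> schwartz_level m (cscale c \<xi>)"
proof (induction m arbitrary: \<xi> rule: less_induct)
  case (less m)
  show ?case
  proof (rule schwartz_levelI)
    show "((\<lambda>y. cscale c \<xi> y k) has_vector_derivative cscale c (partial1 \<xi>) x k) (at x)" for x k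
      using less.prems unfolding cscale_def
      by (intro has_vector_derivative_mult_right schwartz_level_derivative)
    show "rapid (cscale c \<xi>)"
      using less.prems by (intro rapid_cscale schwartz_level_rapid)
    show "schwartz_level j (cscale c (partial1 \<xi>))" if "m = Suc j" for j
      using less that by auto
  qed
qed

lemma schwartz_RZ_cscale: "\<xi> \<in> schwartz_RZ \<Longrightarrow> cscale c \<xi> \<in> schwartz_RZ"
  by (simp add: schwartz_RZ_iff schwartz_level_cscale)

lemma partial1_add:
  "\<xi> \<in> schwartz_RZ \<Longrightarrow> \<eta> \<in> schwartz_RZ \<Longrightarrow> partial1 (\<xi> + \<eta>) = partial1 \<xi> + partial1 \<eta>"
  by (intro partial1_eqI) (auto intro!: has_vector_derivative_add schwartz_RZ_derivative)

lemma partial1_cscale: "\<xi> \<in> schwartz_RZ \<Longrightarrow> partial1 (cscale c \<xi>) = cscale c (partial1 \<xi>)"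
  by (intro partial1_eqI)
    (auto simp: cscale_def intro!: has_vector_derivative_mult_right schwartz_RZ_derivative)

text \<open>The term \<open>cscale \<beta> \<xi>\<close>, from differentiating the factor
  \<open>\<beta> * x\<close>, is the canonical commutation relation; multiplied by
  \<open>\<alpha>\<close> it is the whole curvature.\<close>

lemma has_vector_derivative_nabla2:
  assumes "((\<lambda>y. \<xi> y k) has_vector_derivative partial1 \<xi> x k) (at x)"
  shows "((\<lambda>y. nabla2 \<beta> \<gamma> \<xi> y k) has_vector_derivative
     (cscale \<beta> \<xi> + nabla2 \<beta> \<gamma> (partial1 \<xi>)) x k) (at x)"
proof -
  have "((\<lambda>y. \<beta> * of_real y * \<xi> y k + \<gamma> * of_int k * \<xi> y k) has_vector_derivative
     (\<beta> * of_real x * partial1 \<xi> x k + \<beta> * of_real 1 * \<xi> x k) + \<gamma> * of_int k * partial1 \<xi> x k) (at x)"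
    by (intro has_vector_derivative_add has_vector_derivative_mult has_vector_derivative_mult_right
        has_vector_derivative_of_real DERIV_ident assms)
  then show ?thesis by (simp add: nabla2_def cscale_def algebra_simps)
qed

lemma schwartz_level_nabla2: "schwartz_level m \<xi> \<Longrightarrow> schwartz_level m (nabla2 \<beta> \<gamma> \<xi>)"
proof (induction m arbitrary: \<xi> rule: less_induct)
  case (less m)
  show ?case
  proof (rule schwartz_levelI)
    show "((\<lambda>y. nabla2 \<beta> \<gamma> \<xi> y k) has_vector_derivative
        (cscale \<beta> \<xi> + nabla2 \<beta> \<gamma> (partial1 \<xi>)) x k) (at x)" for x k
      using less.prems by (intro has_vector_derivative_nabla2 schwartz_level_derivative)
    show "rapid (nabla2 \<beta> \<gamma> \<xi>)"
      using less.prems by (intro rapid_nabla2 schwartz_level_rapid)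
    show "schwartz_level j (cscale \<beta> \<xi> + nabla2 \<beta> \<gamma> (partial1 \<xi>))" if j: "m = Suc j" for j
    proof (intro schwartz_level_add schwartz_level_cscale)
      show "schwartz_level j \<xi>"
        by (rule schwartz_level_mono[OF less.prems]) (simp add: j)
      show "schwartz_level j (nabla2 \<beta> \<gamma> (partial1 \<xi>))"
        using less j by auto
    qed
  qed
qed

lemma schwartz_RZ_nabla2: "\<xi> \<in> schwartz_RZ \<Longrightarrow> nabla2 \<beta> \<gamma> \<xi> \<in> schwartz_RZ"
  by (simp add: schwartz_RZ_iff schwartz_level_nabla2)

lemma partial1_nabla2:
  "\<xi> \<in> schwartz_RZ \<Longrightarrow> partial1 (nabla2 \<beta> \<gamma> \<xi>) = cscale \<beta> \<xi> + nabla2 \<beta> \<gamma> (partial1 \<xi>)"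
  by (intro partial1_eqI has_vector_derivative_nabla2 schwartz_RZ_derivative)

subsection \<open>Twisted convolution\<close>

text \<open>Both actions are instances of this sum with \<open>c\<close> the Fourier coefficients of the algebra
  element, and so are the Fourier coefficients of \<open>hmul h f g\<close>, with
  \<open>(a, b, s, e, \<rho>) = (1, 0, 0, - h, 1)\<close>.\<close>

definition twisted_conv ::
  "real \<Rightarrow> real \<Rightarrow> real \<Rightarrow> real \<Rightarrow> int \<Rightarrow>
   (real \<Rightarrow> int \<Rightarrow> complex) \<Rightarrow> (real \<Rightarrow> int \<Rightarrow> complex) \<Rightarrow> real \<Rightarrow> int \<Rightarrow> complex" where
  "twisted_conv a b s e \<rho> c \<xi> = (\<lambda>x k.
     \<Sum>\<^sub>\<infinity>n. c (a * x + b * of_int k - of_int n * s) n * \<xi> (x - of_int n * e) (k - n * \<rho>))"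

text \<open>The central estimate. The point \<open>y\<close> is independent of everything else, so
  the bound holds for whatever affine expression in \<open>x\<close>, \<open>k\<close>,
  \<open>n\<close> is put there.\<close>

lemma rapid_translate_bound:
  assumes c: "rapid c" and \<xi>: "rapid \<xi>"
  obtains C where
    "\<And>x k y n. ((1 + \<bar>x\<bar>) * (1 + \<bar>real_of_int k\<bar>)) ^ p *
       norm (c y n * \<xi> (x - of_int n * e) (k - n * \<rho>)) \<le> C / (1 + \<bar>real_of_int n\<bar>)\<^sup>2"
proof -
  let ?w = "\<lambda>x k. (1 + \<bar>x\<bar>) * (1 + \<bar>real_of_int k\<bar>)"
  let ?N = "\<lambda>n. 1 + \<bar>real_of_int n\<bar>"
  define K where "K = (1 + \<bar>e\<bar>) * (1 + \<bar>real_of_int \<rho>\<bar>)"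
  have K: "K \<ge> 0" by (simp add: K_def)
  \<comment> \<open>Of the exponent \<open>2 * p + 2\<close>, the part \<open>2 * p\<close> pays for
    translation in the two variables \<open>x\<close> and \<open>k\<close>, and the remaining 2
    leaves a summable inverse square.\<close>
  obtain C1 where C1: "C1 \<ge> 0" "\<And>y n. ?w y n ^ (2 * p + 2) * norm (c y n) \<le> C1"
    using rapidE[OF c] by metis
  obtain C2 where C2: "C2 \<ge> 0" "\<And>x k. ?w x k ^ p * norm (\<xi> x k) \<le> C2"
    using rapidE[OF \<xi>] by metis
  \<comment> \<open>A Peetre-type inequality; it is applied once to the real and once to the integer
    variable.\<close>
  have shift: "1 + \<bar>u\<bar> \<le> (1 + \<bar>u - n * v\<bar>) * ((1 + \<bar>n\<bar>) * (1 + \<bar>v\<bar>))" for u n v :: real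
  proof -
    have "1 + \<bar>u\<bar> \<le> 1 + \<bar>u - n * v\<bar> + \<bar>n\<bar> * \<bar>v\<bar>"
      using abs_triangle_ineq[of "u - n * v" "n * v"] by (simp add: abs_mult)
    also have "\<dots> \<le> (1 + \<bar>u - n * v\<bar>) * ((1 + \<bar>n\<bar>) * (1 + \<bar>v\<bar>))"
      by (simp add: distrib_left distrib_right)
    finally show ?thesis .
  qed
  have "?w x k ^ p * norm (c y n * \<xi> (x - of_int n * e) (k - n * \<rho>)) \<le> K ^ p * C1 * C2 / (?N n)\<^sup>2"
    for x k y n
  proof -
    let ?x = "x - of_int n * e" and ?k = "k - n * \<rho>"
    have "?w x k \<le> ((1 + \<bar>?x\<bar>) * (?N n * (1 + \<bar>e\<bar>)))
        * ((1 + \<bar>real_of_int ?k\<bar>) * (?N n * (1 + \<bar>real_of_int \<rho>\<bar>)))"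
      using shift[of x "of_int n" e] shift[of "of_int k" "of_int n" "of_int \<rho>"]
      by (intro mult_mono) auto
    also have "\<dots> = ?w ?x ?k * K * (?N n)\<^sup>2"
      by (simp add: K_def power2_eq_square)
    finally have "?w x k ^ p \<le> (?w ?x ?k * K * (?N n)\<^sup>2) ^ p"
      by (rule power_mono) simp
    then have w: "?w x k ^ p \<le> K ^ p * ?w ?x ?k ^ p * ?N n ^ (2 * p)"
      by (simp only: power_mult_distrib mult_ac power_mult[symmetric])
    have "?N n ^ (2 * p + 2) * norm (c y n) \<le> ?w y n ^ (2 * p + 2) * norm (c y n)"
      by (intro mult_right_mono power_mono) (auto simp: distrib_right)
    also have "\<dots> \<le> C1" by (rule C1)
    finally have "?N n ^ (2 * p) * norm (c y n) * (?N n)\<^sup>2 \<le> C1"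
      by (simp only: power_add mult_ac)
    then have c: "?N n ^ (2 * p) * norm (c y n) \<le> C1 / (?N n)\<^sup>2"
      by (subst pos_le_divide_eq) auto
    have "?w x k ^ p * norm (c y n * \<xi> ?x ?k)
        \<le> K ^ p * ?w ?x ?k ^ p * ?N n ^ (2 * p) * norm (c y n * \<xi> ?x ?k)"
      by (intro mult_right_mono w) simp
    also have "\<dots> = K ^ p * ((?N n ^ (2 * p) * norm (c y n)) * (?w ?x ?k ^ p * norm (\<xi> ?x ?k)))"
      by (simp only: norm_mult mult_ac)
    also have "\<dots> \<le> K ^ p * (C1 / (?N n)\<^sup>2 * C2)"
      by (intro mult_left_mono mult_mono c C2) (use K C1 in auto)
    finally show ?thesis by (simp add: mult_ac)
  qed
  then show ?thesis by (rule that)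
qed

lemma translate_bound:
  assumes "rapid c" "rapid \<xi>"
  obtains C where
    "\<And>x k y n. norm (c y n * \<xi> (x - of_int n * e) (k - n * \<rho>)) \<le> C / (1 + \<bar>real_of_int n\<bar>)\<^sup>2"
  using rapid_translate_bound[OF assms, of 0] by auto

lemma summable_on_int_bound:
  fixes f :: "int \<Rightarrow> complex"
  assumes "\<And>n. norm (f n) \<le> C / (1 + \<bar>real_of_int n\<bar>)\<^sup>2"
  shows "f summable_on UNIV"
    and "norm (\<Sum>\<^sub>\<infinity>n. f n) \<le> C * (\<Sum>\<^sub>\<infinity>n::int. 1 / (1 + \<bar>real_of_int n\<bar>)\<^sup>2)"
proof -
  let ?M = "\<lambda>n::int. 1 / (1 + \<bar>real_of_int n\<bar>)\<^sup>2"
  have M: "(\<lambda>n. C * ?M n) summable_on UNIV"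
    by (intro summable_on_cmult_right summable_inverse_square_int)
  have "(\<lambda>n. norm (f n)) summable_on UNIV"
    by (rule Infinite_Sum.abs_summable_on_comparison_test'[OF M]) (use assms in simp)
  then show s: "f summable_on UNIV" by (rule Infinite_Sum.abs_summable_summable)
  have "norm (\<Sum>\<^sub>\<infinity>n. f n) \<le> (\<Sum>\<^sub>\<infinity>n. C * ?M n)"
    by (rule norm_infsum_le[OF has_sum_infsum[OF s] has_sum_infsum[OF M]]) (use assms in simp)
  then show "norm (\<Sum>\<^sub>\<infinity>n. f n) \<le> C * (\<Sum>\<^sub>\<infinity>n. ?M n)"
    by (simp only: infsum_cmult_right')
qed

lemma summable_twisted_conv:
  assumes "rapid c" "rapid \<xi>"
  shows "(\<lambda>n. c (y n) n * \<xi> (x - of_int n * e) (k - n * \<rho>)) summable_on UNIV"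
proof -
  obtain C where "\<And>x k y n. norm (c y n * \<xi> (x - of_int n * e) (k - n * \<rho>)) \<le> C / (1 + \<bar>real_of_int n\<bar>)\<^sup>2"
    using translate_bound[OF assms] by metis
  then show ?thesis by (intro summable_on_int_bound) blast
qed

lemma rapid_twisted_conv:
  assumes "rapid c" "rapid \<xi>"
  shows "rapid (twisted_conv a b s e \<rho> c \<xi>)"
  unfolding rapid_def
proof
  fix p
  let ?w = "\<lambda>x k. (1 + \<bar>x\<bar>) * (1 + \<bar>real_of_int k\<bar>)"
  let ?S = "\<Sum>\<^sub>\<infinity>n::int. 1 / (1 + \<bar>real_of_int n\<bar>)\<^sup>2"
  obtain C where C: "\<And>x k y n. ?w x k ^ p *
       norm (c y n * \<xi> (x - of_int n * e) (k - n * \<rho>)) \<le> C / (1 + \<bar>real_of_int n\<bar>)\<^sup>2"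
    using rapid_translate_bound[OF assms] by metis
  have "?w x k ^ p * norm (twisted_conv a b s e \<rho> c \<xi> x k) \<le> C * ?S" for x k
  proof -
    \<comment> \<open>The weight is moved under the sum as a complex scalar, where the termwise
      bound already includes it.\<close>
    have "?w x k ^ p * norm (twisted_conv a b s e \<rho> c \<xi> x k)
        = norm (complex_of_real (?w x k ^ p) * twisted_conv a b s e \<rho> c \<xi> x k)"
      by (simp add: norm_mult del: of_real_mult of_real_power)
    also have "\<dots> = norm (\<Sum>\<^sub>\<infinity>n. complex_of_real (?w x k ^ p) *
      (c (a * x + b * of_int k - of_int n * s) n * \<xi> (x - of_int n * e) (k - n * \<rho>)))"
      unfolding twisted_conv_def by (simp only: infsum_cmult_right')
    also have "\<dots> \<le> C * ?S"
      by (rule summable_on_int_bound(2)) (use C in \<open>simp add: norm_mult del: of_real_mult of_real_power\<close>)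
    finally show ?thesis .
  qed
  then show "\<exists>C. \<forall>x k. ?w x k ^ p * norm (twisted_conv a b s e \<rho> c \<xi> x k) \<le> C" by blast
qed

text \<open>At fixed \<open>k\<close> the argument of \<open>c\<close> is affine in \<open>x\<close>
  with slope \<open>a\<close>, and the argument of \<open>\<xi>\<close> has slope 1. The product
  rule therefore reproduces twisted convolutions with the same parameters, which is what makes the
  induction on smoothness close.\<close>

lemma twisted_conv_derivative:
  assumes c: "schwartz_level 1 c" and \<xi>: "schwartz_level 1 \<xi>"
  shows "((\<lambda>y. twisted_conv a b s e \<rho> c \<xi> y k) has_vector_derivative
     (cscale (of_real a) (twisted_conv a b s e \<rho> (partial1 c) \<xi>)
       + twisted_conv a b s e \<rho> c (partial1 \<xi>)) x k) (at x)"
proof -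
  let ?c = "\<lambda>n y. c (a * y + b * of_int k - of_int n * s) n"
  let ?c' = "\<lambda>n y. partial1 c (a * y + b * of_int k - of_int n * s) n"
  let ?\<xi> = "\<lambda>n y. \<xi> (y - of_int n * e) (k - n * \<rho>)"
  let ?\<xi>' = "\<lambda>n y. partial1 \<xi> (y - of_int n * e) (k - n * \<rho>)"
  let ?M = "\<lambda>n::int. 1 / (1 + \<bar>real_of_int n\<bar>)\<^sup>2"
  have r: "rapid c" "rapid \<xi>" "rapid (partial1 c)" "rapid (partial1 \<xi>)"
    using c \<xi> schwartz_level_rapid by auto
  obtain C1 where C1: "\<And>x k y n. norm (c y n * \<xi> (x - of_int n * e) (k - n * \<rho>)) \<le> C1 / (1 + \<bar>real_of_int n\<bar>)\<^sup>2"
    using translate_bound[OF r(1,2)] by metis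
  obtain C2 where C2: "\<And>x k y n. norm (partial1 c y n * \<xi> (x - of_int n * e) (k - n * \<rho>)) \<le> C2 / (1 + \<bar>real_of_int n\<bar>)\<^sup>2"
    using translate_bound[OF r(3,2)] by metis
  obtain C3 where C3: "\<And>x k y n. norm (c y n * partial1 \<xi> (x - of_int n * e) (k - n * \<rho>)) \<le> C3 / (1 + \<bar>real_of_int n\<bar>)\<^sup>2"
    using translate_bound[OF r(1,4)] by metis
  have "((\<lambda>y. \<Sum>\<^sub>\<infinity>n. ?c n y * ?\<xi> n y) has_vector_derivative
      (\<Sum>\<^sub>\<infinity>n. of_real a * (?c' n x * ?\<xi> n x) + ?c n x * ?\<xi>' n x)) (at x)"
  proof (rule has_vector_derivative_infsum)
    fix n :: int and x :: real
    have "((\<lambda>y. a * y + b * of_int k - of_int n * s) has_vector_derivative a) (at x)"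
      by (auto intro!: derivative_eq_intros simp flip: has_real_derivative_iff_has_vector_derivative)
    from vector_diff_chain_at[OF this schwartz_level_derivative[OF c, of n]]
    have 1: "(?c n has_vector_derivative of_real a * ?c' n x) (at x)"
      by (simp add: o_def scaleR_conv_of_real)
    have "((\<lambda>y. y - of_int n * e) has_vector_derivative 1) (at x)"
      by (auto intro!: derivative_eq_intros simp flip: has_real_derivative_iff_has_vector_derivative)
    from vector_diff_chain_at[OF this schwartz_level_derivative[OF \<xi>, of "k - n * \<rho>"]]
    have 2: "(?\<xi> n has_vector_derivative ?\<xi>' n x) (at x)"
      by (simp add: o_def)
    show "((\<lambda>y. ?c n y * ?\<xi> n y) has_vector_derivative
        of_real a * (?c' n x * ?\<xi> n x) + ?c n x * ?\<xi>' n x) (at x)"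
      using has_vector_derivative_mult[OF 1 2] by (simp add: mult_ac add.commute)
    show "norm (?c n x * ?\<xi> n x) \<le> C1 * ?M n"
      using C1 by simp
    have "norm (of_real a * (?c' n x * ?\<xi> n x) + ?c n x * ?\<xi>' n x)
        \<le> \<bar>a\<bar> * norm (?c' n x * ?\<xi> n x) + norm (?c n x * ?\<xi>' n x)"
      by (rule order_trans[OF norm_triangle_ineq]) (simp add: norm_mult)
    also have "\<dots> \<le> \<bar>a\<bar> * (C2 * ?M n) + C3 * ?M n"
      by (intro add_mono mult_left_mono) (use C2 C3 in auto)
    finally show "norm (of_real a * (?c' n x * ?\<xi> n x) + ?c n x * ?\<xi>' n x) \<le> (\<bar>a\<bar> * C2 + C3) * ?M n"
      by (simp only: distrib_right mult.assoc)
  qed (intro summable_on_cmult_right summable_inverse_square_int)+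
  moreover have "(\<Sum>\<^sub>\<infinity>n. of_real a * (?c' n x * ?\<xi> n x) + ?c n x * ?\<xi>' n x)
    = of_real a * (\<Sum>\<^sub>\<infinity>n. ?c' n x * ?\<xi> n x) + (\<Sum>\<^sub>\<infinity>n. ?c n x * ?\<xi>' n x)"
    by (subst infsum_add)
      (auto simp: infsum_cmult_right' intro!: summable_on_cmult_right summable_twisted_conv r)
  ultimately show ?thesis
    by (simp add: twisted_conv_def cscale_def)
qed

text \<open>One level is lost because differentiating the series uses decay of the first derivatives
  of both factors. This is harmless, as \<open>schwartz_RZ\<close> demands all levels.\<close>

lemma schwartz_level_twisted_conv:
  "schwartz_level (Suc m) c \<Longrightarrow> schwartz_level (Suc m) \<xi> \<Longrightarrow>
    schwartz_level m (twisted_conv a b s e \<rho> c \<xi>)"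
proof (induction m arbitrary: c \<xi> rule: less_induct)
  case (less m)
  have 1: "schwartz_level 1 c" "schwartz_level 1 \<xi>"
    by (rule schwartz_level_mono[OF less.prems(1)], simp)
      (rule schwartz_level_mono[OF less.prems(2)], simp)
  show ?case
  proof (rule schwartz_levelI[OF twisted_conv_derivative[OF 1]])
    show "rapid (twisted_conv a b s e \<rho> c \<xi>)"
      using less.prems by (intro rapid_twisted_conv schwartz_level_rapid)
    show "schwartz_level j (cscale (of_real a) (twisted_conv a b s e \<rho> (partial1 c) \<xi>)
        + twisted_conv a b s e \<rho> c (partial1 \<xi>))" if j: "m = Suc j" for j
    proof (intro schwartz_level_add schwartz_level_cscale less.IH)
      show "schwartz_level (Suc j) (partial1 c)" "schwartz_level (Suc j) (partial1 \<xi>)"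
        using less.prems[unfolded j, THEN schwartz_level_partial1] by blast+
      show "schwartz_level (Suc j) c" "schwartz_level (Suc j) \<xi>"
        using less.prems j schwartz_level_mono[of "Suc m" _ "Suc j"] by auto
    qed (use j in auto)
  qed
qed

lemma schwartz_RZ_twisted_conv:
  "c \<in> schwartz_RZ \<Longrightarrow> \<xi> \<in> schwartz_RZ \<Longrightarrow> twisted_conv a b s e \<rho> c \<xi> \<in> schwartz_RZ"
  by (simp only: schwartz_RZ_iff schwartz_level_twisted_conv simp_thms)

lemma partial1_twisted_conv:
  "c \<in> schwartz_RZ \<Longrightarrow> \<xi> \<in> schwartz_RZ \<Longrightarrow>
    partial1 (twisted_conv a b s e \<rho> c \<xi>) =
      cscale (of_real a) (twisted_conv a b s e \<rho> (partial1 c) \<xi>)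
       + twisted_conv a b s e \<rho> c (partial1 \<xi>)"
  by (intro partial1_eqI twisted_conv_derivative schwartz_RZ_level)

section \<open>Bilinearity of the twisted convolution\<close>

lemma twisted_conv_add_left:
  "c \<in> schwartz_RZ \<Longrightarrow> d \<in> schwartz_RZ \<Longrightarrow> \<xi> \<in> schwartz_RZ \<Longrightarrow>
    twisted_conv a b s e \<rho> (c + d) \<xi> = twisted_conv a b s e \<rho> c \<xi> + twisted_conv a b s e \<rho> d \<xi>"
  unfolding twisted_conv_def plus_fun_def distrib_right
  by (intro ext infsum_add summable_twisted_conv schwartz_RZ_rapid)

lemma twisted_conv_add_right:
  "c \<in> schwartz_RZ \<Longrightarrow> \<xi> \<in> schwartz_RZ \<Longrightarrow> \<eta> \<in> schwartz_RZ \<Longrightarrow>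
    twisted_conv a b s e \<rho> c (\<xi> + \<eta>) = twisted_conv a b s e \<rho> c \<xi> + twisted_conv a b s e \<rho> c \<eta>"
  unfolding twisted_conv_def plus_fun_def distrib_left
  by (intro ext infsum_add summable_twisted_conv schwartz_RZ_rapid)

lemma twisted_conv_cscale_left:
  "twisted_conv a b s e \<rho> (cscale z c) \<xi> = cscale z (twisted_conv a b s e \<rho> c \<xi>)"
  by (simp only: twisted_conv_def cscale_def mult.assoc infsum_cmult_right')

lemma twisted_conv_cscale_right:
  "twisted_conv a b s e \<rho> c (cscale z \<xi>) = cscale z (twisted_conv a b s e \<rho> c \<xi>)"
  by (simp only: twisted_conv_def cscale_def mult.left_commute[of _ z] infsum_cmult_right')

subsection \<open>Fourier coefficients\<close>

text \<open>Transitivity, from which the cylinder Schwartz space inherits closure under both partial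
  derivatives.\<close>

lemma partials_mono: "g \<in> partials f \<Longrightarrow> partials g \<subseteq> partials f"
proof
  fix k assume "g \<in> partials f" "k \<in> partials g"
  from this(2,1) show "k \<in> partials f" by induction (auto intro: partials.intros)
qed

lemma schwartz_cyl_differentiable:
  "f \<in> schwartz_cyl \<Longrightarrow> (\<lambda>(u, t). f u t) differentiable (at z)"
  unfolding schwartz_cyl_def using partials.self by blast

lemma schwartz_cyl_periodic: "f \<in> schwartz_cyl \<Longrightarrow> f u (t + 1) = f u t"
  unfolding schwartz_cyl_def by blast

lemma schwartz_cyl_decay:
  assumes "f \<in> schwartz_cyl"
  obtains C where "\<And>u t. \<bar>u\<bar> ^ p * norm (f u t) \<le> C"
  using assms partials.self unfolding schwartz_cyl_def by blast

lemma schwartz_cyl_deriv_fst: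
  assumes "f \<in> schwartz_cyl"
  shows "((\<lambda>s. f s t) has_vector_derivative partial1 f u t) (at u)"
proof -
  have "(\<lambda>s. case (s, t) of (u, t) \<Rightarrow> f u t) differentiable (at u)"
    by (rule differentiable_compose[OF schwartz_cyl_differentiable[OF assms]
          differentiableI[OF has_derivative_Pair[OF has_derivative_ident has_derivative_const]]])
  then show ?thesis by (simp add: partial1_def flip: vector_derivative_works)
qed

lemma schwartz_cyl_deriv_snd:
  assumes "f \<in> schwartz_cyl"
  shows "((\<lambda>s. f u s) has_vector_derivative partial2 f u t) (at t)"
proof -
  have "(\<lambda>s. case (u, s) of (u, t) \<Rightarrow> f u t) differentiable (at t)"
    by (rule differentiable_compose[OF schwartz_cyl_differentiable[OF assms]
          differentiableI[OF has_derivative_Pair[OF has_derivative_const has_derivative_ident]]])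
  then show ?thesis by (simp add: partial2_def flip: vector_derivative_works)
qed

lemma schwartz_cyl_partial1:
  assumes "f \<in> schwartz_cyl"
  shows "partial1 f \<in> schwartz_cyl"
proof -
  have "partial1 f u (t + 1) = partial1 f u t" for u t
    unfolding partial1_def using schwartz_cyl_periodic[OF assms] by simp
  moreover have "partials (partial1 f) \<subseteq> partials f"
    by (intro partials_mono partials.intros)
  ultimately show ?thesis using assms unfolding schwartz_cyl_def by blast
qed

lemma schwartz_cyl_partial2:
  assumes "f \<in> schwartz_cyl"
  shows "partial2 f \<in> schwartz_cyl"
proof -
  have "partial2 f u (t + 1) = partial2 f u t" for u t
  proof -
    \<comment> \<open>Here the period shift acts on the variable of differentiation, so periodicity
      passes to the derivative through the chain rule.\<close>
    have "((\<lambda>s. s + 1) has_vector_derivative 1) (at t)"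
      by (auto intro!: derivative_eq_intros simp flip: has_real_derivative_iff_has_vector_derivative)
    from vector_diff_chain_at[OF this schwartz_cyl_deriv_snd[OF assms]]
    have "((\<lambda>s. f u (s + 1)) has_vector_derivative partial2 f u (t + 1)) (at t)"
      by (simp add: o_def)
    then have "(f u has_vector_derivative partial2 f u (t + 1)) (at t)"
      by (simp add: schwartz_cyl_periodic[OF assms])
    then show ?thesis
      using schwartz_cyl_deriv_snd[OF assms, of u t] vector_derivative_unique_at by blast
  qed
  moreover have "partials (partial2 f) \<subseteq> partials f"
    by (intro partials_mono partials.intros)
  ultimately show ?thesis using assms unfolding schwartz_cyl_def by blast
qed

lemma schwartz_cyl_continuous:
  assumes "f \<in> schwartz_cyl"
  shows "continuous_on S (\<lambda>(u, t). f u t)"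
  by (meson assms continuous_at_imp_continuous_on differentiable_imp_continuous_within
      schwartz_cyl_differentiable)

section \<open>The characters of the circle and their orthogonality\<close>

lemma W_powi: "W t powi n = exp (2 * of_real pi * \<i> * of_int n * of_real t)"
  unfolding W_def exp_power_int by (simp add: mult_ac)

lemma norm_W_powi [simp]: "norm (W t powi n) = 1"
  unfolding W_powi norm_exp_eq_Re by simp

lemma W_nonzero [simp]: "W t \<noteq> 0"
  by (simp add: W_def)

lemma W_0 [simp]: "W 0 = 1" and W_1 [simp]: "W 1 = 1"
  using exp_two_pi_i by (simp_all add: W_def mult_ac)

lemma has_vector_derivative_W_powi:
  "((\<lambda>t. W t powi n) has_vector_derivative 2 * of_real pi * \<i> * of_int n * W t powi n) (at t)"
proof -
  let ?c = "2 * of_real pi * \<i> * of_int n :: complex"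
  have "((\<lambda>z. exp (?c * z)) has_field_derivative ?c * exp (?c * of_real t)) (at (of_real t))"
    by (auto intro!: derivative_eq_intros)
  from has_vector_derivative_real_field[OF this] show ?thesis
    by (simp add: W_powi)
qed

lemma continuous_on_W_powi [continuous_intros]: "continuous_on S (\<lambda>t. W t powi n)"
  unfolding W_powi by (intro continuous_intros)

lemma integral_W_powi: "integral {0..1} (\<lambda>t. W t powi n) = (if n = 0 then 1 else 0)"
proof (cases "n = 0")
  case False
  let ?c = "2 * of_real pi * \<i> * of_int n :: complex"
  have "((\<lambda>t. ?c * W t powi n) has_integral W 1 powi n - W 0 powi n) {0..1}"
    by (intro fundamental_theorem_of_calculus)
      (auto intro: has_vector_derivative_at_within[OF has_vector_derivative_W_powi])
  from integral_unique[OF this] have "?c * integral {0..1} (\<lambda>t. W t powi n) = 0"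
    by simp
  then show ?thesis using False by simp
qed simp

text \<open>Absolute summability makes the series converge uniformly along finite index sets, so
  integral and sum may be exchanged; orthogonality then leaves one term.\<close>

lemma integral_trig_series:
  assumes d: "(\<lambda>n. norm (d n :: complex)) summable_on UNIV"
  shows "integral {0..1} (\<lambda>t. (\<Sum>\<^sub>\<infinity>n. d n * W t powi n) * W t powi (- m)) = d m"
proof -
  let ?f = "\<lambda>n t. d n * W t powi (n - m)"
  let ?F = "finite_subsets_at_top (UNIV :: int set)"
  have eq: "(\<Sum>\<^sub>\<infinity>n. ?f n t) = (\<Sum>\<^sub>\<infinity>n. d n * W t powi n) * W t powi (- m)" for t
  proof -
    have "?f n t = d n * W t powi n * W t powi (- m)" for n
      using power_int_add[of "W t" n "- m"] by simp
    then show ?thesis by (simp only: infsum_cmult_left')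
  qed
  have u: "uniform_limit {0..1} (\<lambda>X t. \<Sum>n\<in>X. ?f n t) (\<lambda>t. \<Sum>\<^sub>\<infinity>n. ?f n t) ?F"
    by (rule Weierstrass_m_test_general[OF _ d]) (simp add: norm_mult)
  have cont: "continuous_on {0..1} (\<lambda>t. \<Sum>n\<in>X. ?f n t)" for X
    by (intro continuous_on_sum continuous_on_mult continuous_on_const continuous_on_W_powi)
  obtain I J where
    I: "\<And>X. ((\<lambda>t. \<Sum>n\<in>X. ?f n t) has_integral I X) {0..1}" and
    J: "((\<lambda>t. \<Sum>\<^sub>\<infinity>n. ?f n t) has_integral J) {0..1}" and lim: "(I \<longlongrightarrow> J) ?F"
    by (rule uniform_limit_integral[OF u cont]) (simp, rule that)
  \<comment> \<open>The net of partial integrals is constant as soon as the index set contains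
    \<open>m\<close>, which determines its limit.\<close>
  have "I X = d m" if "finite X" "m \<in> X" for X
  proof -
    have "I X = integral {0..1} (\<lambda>t. \<Sum>n\<in>X. ?f n t)"
      by (rule integral_unique[OF I, symmetric])
    also have "\<dots> = (\<Sum>n\<in>X. integral {0..1} (?f n))"
      using that by (intro integral_sum integrable_continuous_real continuous_on_mult
          continuous_on_const continuous_on_W_powi)
    also have "\<dots> = (\<Sum>n\<in>X. if n = m then d m else 0)"
      by (intro sum.cong) (auto simp: integral_W_powi)
    finally show ?thesis using that by simp
  qed
  then have "\<forall>\<^sub>F X in ?F. I X = d m"
    unfolding eventually_finite_subsets_at_top by (intro exI[of _ "{m}"]) auto
  then have "(I \<longlongrightarrow> d m) ?F"
    by (rule tendsto_eventually)
  with lim have "J = d m"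
    using tendsto_unique[of ?F I] by simp
  with integral_unique[OF J] show ?thesis
    by (simp only: eq)
qed

text \<open>The argument order matches \<open>schwartz_RZ\<close>, so that \<open>partial1\<close>,
  \<open>nabla2\<close> and \<open>twisted_conv\<close> apply to coefficient families and module
  elements alike.\<close>

definition fourier :: "(real \<Rightarrow> real \<Rightarrow> complex) \<Rightarrow> real \<Rightarrow> int \<Rightarrow> complex" where
  "fourier f = (\<lambda>u n. fcoeff f n u)"

lemma continuous_on_fcoeff_integrand:
  assumes "f \<in> schwartz_cyl"
  shows "continuous_on S (\<lambda>t. f u t * W t powi n)"
proof -
  have "continuous_on S (\<lambda>t. case (u, t) of (u, t) \<Rightarrow> f u t)"
    by (rule continuous_on_compose2[OF schwartz_cyl_continuous[OF assms, of UNIV]])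
      (auto intro!: continuous_intros)
  then show ?thesis by (auto intro!: continuous_intros)
qed

lemma integrable_fcoeff_integrand:
  "f \<in> schwartz_cyl \<Longrightarrow> (\<lambda>t. f u t * W t powi n) integrable_on {0..1}"
  by (intro integrable_continuous_real continuous_on_fcoeff_integrand)

text \<open>The characters have modulus 1 and the circle has length 1, so no constant appears. The
  factor \<open>a\<close> stands for a power of \<open>|u|\<close> and may vanish, which is why that
  case is separate.\<close>

lemma norm_fcoeff_le:
  assumes f: "f \<in> schwartz_cyl" and a: "a \<ge> 0" and B: "\<And>t. a * norm (f u t) \<le> B"
  shows "a * norm (fcoeff f n u) \<le> B"
proof (cases "a = 0")
  case True
  then show ?thesis using B[of 0] by simp
next
  case False
  with a have "a > 0" by simp
  have "norm (fcoeff f n u) \<le> B / a * (1 - 0)"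
    unfolding fcoeff_def
  proof (rule integral_bound)
    show "norm (f u t * W t powi (- n)) \<le> B / a" for t
      using B[of t] \<open>a > 0\<close> by (simp add: norm_mult field_simps)
  qed (use continuous_on_fcoeff_integrand[OF f] in auto)
  then show ?thesis using \<open>a > 0\<close> by (simp add: field_simps)
qed

text \<open>Integration by parts; the boundary terms cancel by periodicity.\<close>

lemma fcoeff_partial2:
  assumes f: "f \<in> schwartz_cyl"
  shows "fcoeff (partial2 f) n u = 2 * of_real pi * \<i> * of_int n * fcoeff f n u"
proof -
  let ?c = "2 * of_real pi * \<i> * of_int n :: complex"
  have "((\<lambda>t. f u t * W t powi (- n)) has_vector_derivative
      f u t * (2 * of_real pi * \<i> * of_int (- n) * W t powi (- n)) + partial2 f u t * W t powi (- n)) (at t)" for t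
    by (intro has_vector_derivative_mult schwartz_cyl_deriv_snd[OF f] has_vector_derivative_W_powi)
  then have D: "((\<lambda>t. f u t * W t powi (- n)) has_vector_derivative
      partial2 f u t * W t powi (- n) - ?c * (f u t * W t powi (- n))) (at t)" for t
    by (simp add: algebra_simps)
  have "((\<lambda>t. partial2 f u t * W t powi (- n) - ?c * (f u t * W t powi (- n)))
      has_integral (f u 1 * W 1 powi (- n) - f u 0 * W 0 powi (- n))) {0..1}"
    by (intro fundamental_theorem_of_calculus) (auto intro: has_vector_derivative_at_within[OF D])
  from integral_unique[OF this] have "integral {0..1} (\<lambda>t. partial2 f u t * W t powi (- n) - ?c * (f u t * W t powi (- n))) = 0"
    using schwartz_cyl_periodic[OF f, of u 0] by simp
  moreover have "integral {0..1} (\<lambda>t. partial2 f u t * W t powi (- n) - ?c * (f u t * W t powi (- n)))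
      = fcoeff (partial2 f) n u - ?c * fcoeff f n u"
    unfolding fcoeff_def
    by (subst integral_diff)
      (use f in \<open>auto intro!: integrable_fcoeff_integrand schwartz_cyl_partial2 integrable_on_mult_right\<close>)
  ultimately show ?thesis by simp
qed

lemma fcoeff_partial2_funpow:
  assumes f: "f \<in> schwartz_cyl"
  shows "(partial2 ^^ q) f \<in> schwartz_cyl \<and>
    fcoeff ((partial2 ^^ q) f) n u = (2 * of_real pi * \<i> * of_int n) ^ q * fcoeff f n u"
  by (induction q) (auto simp: f schwartz_cyl_partial2 fcoeff_partial2)

lemma rapid_fourier:
  assumes f: "f \<in> schwartz_cyl"
  shows "rapid (fourier f)"
  unfolding rapid_iff
proof (intro allI)
  fix p q
  let ?g = "(partial2 ^^ q) f"
  have g: "?g \<in> schwartz_cyl" using fcoeff_partial2_funpow[OF f] by blast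
  obtain C where C: "\<And>u t. \<bar>u\<bar> ^ p * norm (?g u t) \<le> C"
    using schwartz_cyl_decay[OF g] by metis
  have "\<bar>u\<bar> ^ p * \<bar>real_of_int n\<bar> ^ q * norm (fourier f u n) \<le> C" for u n
  proof -
    have "1 * \<bar>real_of_int n\<bar> \<le> 2 * pi * \<bar>real_of_int n\<bar>"
      using pi_gt3 by (intro mult_right_mono) auto
    then have "\<bar>real_of_int n\<bar> ^ q \<le> (2 * pi * \<bar>real_of_int n\<bar>) ^ q"
      by (intro power_mono) auto
    then have "\<bar>u\<bar> ^ p * \<bar>real_of_int n\<bar> ^ q * norm (fourier f u n)
        \<le> \<bar>u\<bar> ^ p * (2 * pi * \<bar>real_of_int n\<bar>) ^ q * norm (fourier f u n)"
      by (intro mult_right_mono mult_left_mono) auto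
    also have "\<dots> = \<bar>u\<bar> ^ p * norm (fcoeff ?g n u)"
      using fcoeff_partial2_funpow[OF f, of q n u]
      by (simp add: fourier_def norm_mult norm_power)
    also have "\<dots> \<le> C"
      by (rule norm_fcoeff_le[OF g]) (use C in auto)
    finally show ?thesis .
  qed
  then show "\<exists>C. \<forall>u n. \<bar>u\<bar> ^ p * \<bar>real_of_int n\<bar> ^ q * norm (fourier f u n) \<le> C" by blast
qed

text \<open>Differentiation under the integral sign, justified by joint continuity of
  \<open>partial1 f\<close>, itself a Schwartz function on the cylinder.\<close>

lemma has_vector_derivative_fourier:
  assumes f: "f \<in> schwartz_cyl"
  shows "((\<lambda>u. fourier f u n) has_vector_derivative fourier (partial1 f) u n) (at u)"
proof -
  have "((\<lambda>u. integral (cbox 0 1) (\<lambda>t. f u t * W t powi (- n))) has_vector_derivative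
      integral (cbox 0 1) (\<lambda>t. partial1 f u t * W t powi (- n))) (at u within UNIV)"
  proof (rule leibniz_rule_vector_derivative)
    show "((\<lambda>u. f u t * W t powi (- n)) has_vector_derivative partial1 f u t * W t powi (- n))
        (at u within UNIV)" for u t
      using schwartz_cyl_deriv_fst[OF f] by (auto intro!: has_vector_derivative_mult_left)
    show "(\<lambda>t. f u t * W t powi (- n)) integrable_on cbox 0 1" for u
      using integrable_fcoeff_integrand[OF f] by simp
    have "continuous_on (UNIV \<times> cbox 0 1) (\<lambda>z. (case z of (u, t) \<Rightarrow> partial1 f u t) * W (snd z) powi (- n))"
      by (intro continuous_on_mult schwartz_cyl_continuous schwartz_cyl_partial1 f
          continuous_on_compose2[OF continuous_on_W_powi[of UNIV]] continuous_on_snd continuous_on_id) auto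
    then show "continuous_on (UNIV \<times> cbox 0 1) (\<lambda>(u, t). partial1 f u t * W t powi (- n))"
      by (simp add: case_prod_unfold)
  qed auto
  then show ?thesis by (simp add: fourier_def fcoeff_def)
qed

lemma fourier_schwartz_RZ:
  assumes "f \<in> schwartz_cyl"
  shows "fourier f \<in> schwartz_RZ"
proof -
  have "schwartz_level m (fourier f)" for m
    using assms
  proof (induction m arbitrary: f rule: less_induct)
    case (less m)
    show ?case
      by (rule schwartz_levelI[OF has_vector_derivative_fourier rapid_fourier])
        (use less in \<open>auto intro: schwartz_cyl_partial1\<close>)
  qed
  then show ?thesis by (simp add: schwartz_RZ_iff)
qed

section \<open>Coefficients of sums, products and derivations\<close>

lemma fourier_add:
  "f \<in> schwartz_cyl \<Longrightarrow> g \<in> schwartz_cyl \<Longrightarrow> fourier (f + g) = fourier f + fourier g"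
  by (auto simp: fourier_def fcoeff_def fun_eq_iff distrib_right
      intro!: integral_add integrable_fcoeff_integrand)

lemma fourier_cscale: "fourier (cscale c f) = cscale c (fourier f)"
  by (simp add: fourier_def fcoeff_def cscale_def mult.assoc)

text \<open>Since \<open>hmul\<close>, \<open>deriv1\<close> and \<open>deriv2\<close> are defined
  as trigonometric series, this computes all their coefficients.\<close>

lemma fourier_series:
  assumes "rapid c"
  shows "fourier (\<lambda>u t. \<Sum>\<^sub>\<infinity>n. c u n * W t powi n) = c"
proof (intro ext)
  fix u n
  obtain C where "\<And>u n. norm (c u n) \<le> C / (1 + \<bar>real_of_int n\<bar>)\<^sup>2"
    using rapid_bound[OF assms] by metis
  then have "norm (c u n) \<le> C * (1 / (1 + \<bar>real_of_int n\<bar>)\<^sup>2)" for n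
    by simp
  then have "(\<lambda>n. norm (c u n)) summable_on UNIV"
    by (intro Infinite_Sum.abs_summable_on_comparison_test'[OF
          summable_on_cmult_right[OF summable_inverse_square_int]])
  from integral_trig_series[OF this]
  show "fourier (\<lambda>u t. \<Sum>\<^sub>\<infinity>n. c u n * W t powi n) u n = c u n"
    by (simp add: fourier_def fcoeff_def)
qed

lemma fourier_hmul:
  assumes "f \<in> schwartz_cyl" "g \<in> schwartz_cyl"
  shows "fourier (hmul h f g) = twisted_conv 1 0 0 (- h) 1 (fourier f) (fourier g)"
proof -
  have "hmul h f g = (\<lambda>u t. \<Sum>\<^sub>\<infinity>n.
      twisted_conv 1 0 0 (- h) 1 (fourier f) (fourier g) u n * W t powi n)"
    by (simp add: hmul_def twisted_conv_def fourier_def)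
  then show ?thesis
    by (simp only: fourier_series[OF rapid_twisted_conv] rapid_fourier assms)
qed

lemma fourier_deriv1:
  assumes "f \<in> schwartz_cyl"
  shows "fourier (deriv1 f) = partial1 (fourier f)"
proof -
  have "deriv1 f = (\<lambda>u t. \<Sum>\<^sub>\<infinity>n. partial1 (fourier f) u n * W t powi n)"
    by (simp add: deriv1_def partial1_def fourier_def)
  then show ?thesis
    by (simp only: fourier_series[OF schwartz_RZ_rapid] schwartz_RZ_partial1 fourier_schwartz_RZ assms)
qed

lemma fourier_deriv2:
  assumes "f \<in> schwartz_cyl"
  shows "fourier (deriv2 f) = nabla2 0 (2 * of_real pi * \<i>) (fourier f)"
proof -
  have "deriv2 f = (\<lambda>u t. \<Sum>\<^sub>\<infinity>n. nabla2 0 (2 * of_real pi * \<i>) (fourier f) u n * W t powi n)"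
    by (simp add: deriv2_def nabla2_def fourier_def mult.assoc infsum_cmult_right')
  then show ?thesis
    by (simp only: fourier_series[OF rapid_nabla2] rapid_fourier assms)
qed

subsection \<open>The bimodule and its connection\<close>

text \<open>The two coefficient factors supply decay in the two summation indices, and mere
  boundedness of \<open>\<xi>\<close> suffices. All arguments are free, so one bound serves each of
  the three module identities.\<close>

lemma triple_product_bound:
  assumes "rapid c" "rapid d" "rapid \<xi>"
  obtains C where "\<And>u v x j m k. norm (c u j * d v m * \<xi> x k)
    \<le> C / ((1 + \<bar>real_of_int j\<bar>)\<^sup>2 * (1 + \<bar>real_of_int m\<bar>)\<^sup>2)"
proof -
  obtain C1 where C1: "C1 \<ge> 0" "\<And>u n. norm (c u n) \<le> C1 / (1 + \<bar>real_of_int n\<bar>)\<^sup>2"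
    using rapid_bound[OF assms(1)] by metis
  obtain C2 where C2: "C2 \<ge> 0" "\<And>u n. norm (d u n) \<le> C2 / (1 + \<bar>real_of_int n\<bar>)\<^sup>2"
    using rapid_bound[OF assms(2)] by metis
  obtain C3 where C3: "C3 \<ge> 0" "\<And>u n. norm (\<xi> u n) \<le> C3"
    using rapid_bound[OF assms(3)] by metis
  have "norm (c u j * d v m * \<xi> x k)
      \<le> C1 / (1 + \<bar>real_of_int j\<bar>)\<^sup>2 * (C2 / (1 + \<bar>real_of_int m\<bar>)\<^sup>2) * C3" for u v x j m k
    unfolding norm_mult by (intro mult_mono C1(2) C2(2) C3(2)) (use C1(1) C2(1) C3(1) in auto)
  then show ?thesis by (intro that[of "C1 * C2 * C3"]) simp
qed

text \<open>Translating the module argument by \<open>j\<close> steps moves the argument of the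
  inner coefficient by \<open>- j * (a * e + b * \<rho>) = j * h\<close>, exactly the shift built
  into the product.\<close>

lemma twisted_conv_assoc_left:
  assumes f: "f \<in> schwartz_RZ" and g: "g \<in> schwartz_RZ" and \<xi>: "\<xi> \<in> schwartz_RZ"
    and h: "a * e + b * of_int \<rho> = - h"
  shows "twisted_conv a b 0 e \<rho> (twisted_conv 1 0 0 (- h) 1 f g) \<xi>
    = twisted_conv a b 0 e \<rho> f (twisted_conv a b 0 e \<rho> g \<xi>)"
proof (intro ext)
  fix x k
  define u where "u = a * x + b * of_int k"
  \<comment> \<open>The contribution of degrees \<open>j\<close> and \<open>m\<close>; both sides
    sum it, one of them grouped by total degree \<open>j + m\<close>.\<close>
  define F where "F j m = f u j * g (u + of_int j * h) m *
    \<xi> (x - of_int (j + m) * e) (k - (j + m) * \<rho>)" for j m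
  obtain C where "\<And>u v x j m k. norm (f u j * g v m * \<xi> x k)
      \<le> C / ((1 + \<bar>real_of_int j\<bar>)\<^sup>2 * (1 + \<bar>real_of_int m\<bar>)\<^sup>2)"
    using triple_product_bound[OF f[THEN schwartz_RZ_rapid] g[THEN schwartz_RZ_rapid] \<xi>[THEN schwartz_RZ_rapid]] by metis
  then have F: "norm (F j m) \<le> C / ((1 + \<bar>real_of_int j\<bar>)\<^sup>2 * (1 + \<bar>real_of_int m\<bar>)\<^sup>2)" for j m
    unfolding F_def by blast
  have "twisted_conv a b 0 e \<rho> (twisted_conv 1 0 0 (- h) 1 f g) \<xi> x k
      = (\<Sum>\<^sub>\<infinity>n. \<Sum>\<^sub>\<infinity>j. F j (n - j))"
    by (simp add: twisted_conv_def F_def flip: infsum_cmult_left' u_def)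
  also have "\<dots> = (\<Sum>\<^sub>\<infinity>j. \<Sum>\<^sub>\<infinity>m. F j m)"
    by (rule infsum_int_convolution[OF F])
  also have "\<dots> = twisted_conv a b 0 e \<rho> f (twisted_conv a b 0 e \<rho> g \<xi>) x k"
    unfolding twisted_conv_def infsum_cmult_right'[symmetric]
  proof (intro infsum_cong)
    fix j m
    have "a * (x - of_int j * e) + b * of_int (k - j * \<rho>) = u - of_int j * (a * e + b * of_int \<rho>)"
      by (simp add: u_def algebra_simps)
    also have "\<dots> = u + of_int j * h"
      by (simp add: h)
    finally have E: "a * (x - of_int j * e) + b * of_int (k - j * \<rho>) = u + of_int j * h" .
    show "F j m = f (a * x + b * of_int k - of_int j * 0) j *
      (g (a * (x - of_int j * e) + b * of_int (k - j * \<rho>) - of_int m * 0) m *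
       \<xi> (x - of_int j * e - of_int m * e) (k - j * \<rho> - m * \<rho>))"
      unfolding E by (simp add: F_def u_def algebra_simps)
  qed
  finally show "twisted_conv a b 0 e \<rho> (twisted_conv 1 0 0 (- h) 1 f g) \<xi> x k
    = twisted_conv a b 0 e \<rho> f (twisted_conv a b 0 e \<rho> g \<xi>) x k" .
qed

text \<open>With the argument lowered by \<open>h\<close> per degree, the product shift takes
  \<open>g\<close> from \<open>u - (j + m) * h\<close> to \<open>u - m * h\<close>. On the other
  side, translation by \<open>m\<close> steps lowers the argument of the inner \<open>f\<close> by
  the same \<open>m * h\<close>.\<close>

lemma twisted_conv_assoc_right:
  assumes f: "f \<in> schwartz_RZ" and g: "g \<in> schwartz_RZ" and \<xi>: "\<xi> \<in> schwartz_RZ"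
    and h: "a * e + b * of_int \<rho> = h"
  shows "twisted_conv a b h e \<rho> (twisted_conv 1 0 0 (- h) 1 f g) \<xi>
    = twisted_conv a b h e \<rho> g (twisted_conv a b h e \<rho> f \<xi>)"
proof (intro ext)
  fix x k
  define u where "u = a * x + b * of_int k"
  define F where "F j m = f (u - of_int (j + m) * h) j * g (u - of_int m * h) m *
    \<xi> (x - of_int (j + m) * e) (k - (j + m) * \<rho>)" for j m
  obtain C where "\<And>u v x j m k. norm (f u j * g v m * \<xi> x k)
      \<le> C / ((1 + \<bar>real_of_int j\<bar>)\<^sup>2 * (1 + \<bar>real_of_int m\<bar>)\<^sup>2)"
    using triple_product_bound[OF f[THEN schwartz_RZ_rapid] g[THEN schwartz_RZ_rapid] \<xi>[THEN schwartz_RZ_rapid]] by metis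
  then have F: "norm (F j m) \<le> C / ((1 + \<bar>real_of_int j\<bar>)\<^sup>2 * (1 + \<bar>real_of_int m\<bar>)\<^sup>2)" for j m
    unfolding F_def by blast
  have "twisted_conv a b h e \<rho> (twisted_conv 1 0 0 (- h) 1 f g) \<xi> x k
      = (\<Sum>\<^sub>\<infinity>n. \<Sum>\<^sub>\<infinity>j. F j (n - j))"
    unfolding twisted_conv_def infsum_cmult_left'[symmetric]
    by (intro infsum_cong) (simp add: F_def u_def algebra_simps)
  also have "\<dots> = (\<Sum>\<^sub>\<infinity>j. \<Sum>\<^sub>\<infinity>m. F j m)"
    by (rule infsum_int_convolution[OF F])
  \<comment> \<open>In a right action the second factor \<open>g\<close> acts last, so its index
    \<open>m\<close> becomes the outer one.\<close>
  also have "\<dots> = (\<Sum>\<^sub>\<infinity>m. \<Sum>\<^sub>\<infinity>j. F j m)"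
    by (rule infsum_int_swap[OF F])
  also have "\<dots> = twisted_conv a b h e \<rho> g (twisted_conv a b h e \<rho> f \<xi>) x k"
    unfolding twisted_conv_def infsum_cmult_right'[symmetric]
  proof (intro infsum_cong)
    fix m j
    have "a * (x - of_int m * e) + b * of_int (k - m * \<rho>) = u - of_int m * (a * e + b * of_int \<rho>)"
      by (simp add: u_def algebra_simps)
    also have "\<dots> = u - of_int m * h"
      by (simp add: h)
    finally have "a * (x - of_int m * e) + b * of_int (k - m * \<rho>) - of_int j * h
        = u - of_int (j + m) * h"
      by (simp add: algebra_simps)
    then show "F j m = g (a * x + b * of_int k - of_int m * h) m *
      (f (a * (x - of_int m * e) + b * of_int (k - m * \<rho>) - of_int j * h) j *
       \<xi> (x - of_int m * e - of_int j * e) (k - m * \<rho> - j * \<rho>))"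
      by (simp add: F_def u_def algebra_simps)
  qed
  finally show "twisted_conv a b h e \<rho> (twisted_conv 1 0 0 (- h) 1 f g) \<xi> x k
    = twisted_conv a b h e \<rho> g (twisted_conv a b h e \<rho> f \<xi>) x k" .
qed

text \<open>The two vanishing conditions say that the translations of either action fix the
  coefficient argument of the other. Both sides are then one double series summed in opposite
  orders.\<close>

lemma twisted_conv_commute:
  assumes f: "f \<in> schwartz_RZ" and g: "g \<in> schwartz_RZ" and \<xi>: "\<xi> \<in> schwartz_RZ"
    and "a * e' + b * of_int \<rho>' = 0" and "a' * e + b' * of_int \<rho> = 0"
  shows "twisted_conv a' b' s' e' \<rho>' g (twisted_conv a b s e \<rho> f \<xi>)
    = twisted_conv a b s e \<rho> f (twisted_conv a' b' s' e' \<rho>' g \<xi>)"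
proof (intro ext)
  fix x k
  define F where "F m n = f (a * x + b * of_int k - of_int m * s) m *
    g (a' * x + b' * of_int k - of_int n * s') n *
    \<xi> (x - of_int m * e - of_int n * e') (k - m * \<rho> - n * \<rho>')" for m n
  obtain C where "\<And>u v x j m k. norm (f u j * g v m * \<xi> x k)
      \<le> C / ((1 + \<bar>real_of_int j\<bar>)\<^sup>2 * (1 + \<bar>real_of_int m\<bar>)\<^sup>2)"
    using triple_product_bound[OF f[THEN schwartz_RZ_rapid] g[THEN schwartz_RZ_rapid] \<xi>[THEN schwartz_RZ_rapid]] by metis
  then have F: "norm (F j m) \<le> C / ((1 + \<bar>real_of_int j\<bar>)\<^sup>2 * (1 + \<bar>real_of_int m\<bar>)\<^sup>2)" for j m
    unfolding F_def by blast
  have 1: "a * (x - of_int n * e') + b * of_int (k - n * \<rho>') = a * x + b * of_int k" for n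
  proof -
    have "a * (x - of_int n * e') + b * of_int (k - n * \<rho>')
        = a * x + b * of_int k - of_int n * (a * e' + b * of_int \<rho>')"
      by (simp add: algebra_simps)
    then show ?thesis by (simp only: assms mult_zero_right diff_zero)
  qed
  have 2: "a' * (x - of_int n * e) + b' * of_int (k - n * \<rho>) = a' * x + b' * of_int k" for n
  proof -
    have "a' * (x - of_int n * e) + b' * of_int (k - n * \<rho>)
        = a' * x + b' * of_int k - of_int n * (a' * e + b' * of_int \<rho>)"
      by (simp add: algebra_simps)
    then show ?thesis by (simp only: assms mult_zero_right diff_zero)
  qed
  have "twisted_conv a' b' s' e' \<rho>' g (twisted_conv a b s e \<rho> f \<xi>) x k = (\<Sum>\<^sub>\<infinity>n. \<Sum>\<^sub>\<infinity>m. F m n)"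
    unfolding twisted_conv_def infsum_cmult_right'[symmetric] 1
    by (intro infsum_cong) (simp add: F_def algebra_simps)
  also have "\<dots> = (\<Sum>\<^sub>\<infinity>m. \<Sum>\<^sub>\<infinity>n. F m n)"
    by (rule infsum_int_swap[OF F, symmetric])
  also have "\<dots> = twisted_conv a b s e \<rho> f (twisted_conv a' b' s' e' \<rho>' g \<xi>) x k"
    unfolding twisted_conv_def infsum_cmult_right'[symmetric] 2
    by (intro infsum_cong) (simp add: F_def algebra_simps)
  finally show "twisted_conv a' b' s' e' \<rho>' g (twisted_conv a b s e \<rho> f \<xi>) x k
    = twisted_conv a b s e \<rho> f (twisted_conv a' b' s' e' \<rho>' g \<xi>) x k" .
qed

section \<open>Linearity and Leibniz rules\<close>

lemma left_act_eq: "left_act l0 l1 e \<rho> f \<xi> = twisted_conv l0 l1 0 e \<rho> (fourier f) \<xi>"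
  by (simp add: left_act_def twisted_conv_def fourier_def)

lemma right_act_eq: "right_act l0 m1 e \<rho> h \<xi> f = twisted_conv l0 m1 h e \<rho> (fourier f) \<xi>"
  by (simp add: right_act_def twisted_conv_def fourier_def)

lemma nabla1_eq: "nabla1 \<alpha> \<xi> = cscale (of_real \<alpha>) (partial1 \<xi>)"
  by (simp add: nabla1_def cscale_def)

lemma cscale_add: "cscale z (f + g) = cscale z f + cscale z g"
  by (simp add: cscale_def fun_eq_iff distrib_left)

lemma cscale_cscale: "cscale z (cscale w f) = cscale (z * w) f"
  by (simp add: cscale_def mult.assoc)

lemma cscale_1: "cscale 1 f = f"
  by (simp add: cscale_def)

lemma nabla2_add: "nabla2 \<beta> \<gamma> (\<xi> + \<eta>) = nabla2 \<beta> \<gamma> \<xi> + nabla2 \<beta> \<gamma> \<eta>"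
  by (simp add: nabla2_def fun_eq_iff distrib_left)

lemma nabla2_cscale: "nabla2 \<beta> \<gamma> (cscale z \<xi>) = cscale z (nabla2 \<beta> \<gamma> \<xi>)"
  by (simp add: nabla2_def cscale_def fun_eq_iff algebra_simps)

lemma linear_endo_twisted_conv:
  "c \<in> schwartz_RZ \<Longrightarrow> linear_endo (twisted_conv a b s e \<rho> c)"
  by (auto simp: linear_endo_def schwartz_RZ_twisted_conv twisted_conv_add_right
      twisted_conv_cscale_right)

lemma linear_endo_nabla1: "linear_endo (nabla1 \<alpha>)"
  by (auto simp: linear_endo_def nabla1_eq partial1_add partial1_cscale cscale_add cscale_cscale
      mult.commute intro: schwartz_RZ_cscale schwartz_RZ_partial1)

lemma linear_endo_nabla2: "linear_endo (nabla2 \<beta> \<gamma>)"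
  by (auto simp: linear_endo_def nabla2_add nabla2_cscale intro: schwartz_RZ_nabla2)

text \<open>The normalisation \<open>\<alpha> * a = 1\<close> cancels the chain rule factor, leaving
  the plain derivative of the coefficients.\<close>

lemma nabla1_twisted_conv:
  assumes "c \<in> schwartz_RZ" "\<xi> \<in> schwartz_RZ" "\<alpha> * a = 1"
  shows "nabla1 \<alpha> (twisted_conv a b s e \<rho> c \<xi>)
    = twisted_conv a b s e \<rho> c (nabla1 \<alpha> \<xi>) + twisted_conv a b s e \<rho> (partial1 c) \<xi>"
proof -
  have "complex_of_real \<alpha> * of_real a = 1"
    using assms(3) by (metis of_real_1 of_real_mult)
  then show ?thesis
    by (simp only: nabla1_eq partial1_twisted_conv[OF assms(1,2)] cscale_add cscale_cscale cscale_1
        twisted_conv_cscale_right add.commute)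
qed

text \<open>In the n-th term split \<open>x = (x - n * e) + n * e\<close> and
  \<open>k = (k - n * \<rho>) + n * \<rho>\<close>. The first parts multiply \<open>\<xi>\<close>,
  the second contribute \<open>n * w\<close>, which multiplies the n-th coefficient; for
  \<open>w = 2 pi i\<close> that is the second derivation.\<close>

lemma nabla2_twisted_conv:
  assumes c: "c \<in> schwartz_RZ" and \<xi>: "\<xi> \<in> schwartz_RZ"
    and w: "\<beta> * of_real e + \<gamma> * of_int \<rho> = w"
  shows "nabla2 \<beta> \<gamma> (twisted_conv a b s e \<rho> c \<xi>)
    = twisted_conv a b s e \<rho> c (nabla2 \<beta> \<gamma> \<xi>) + twisted_conv a b s e \<rho> (nabla2 0 w c) \<xi>"
proof (intro ext)
  fix x k
  let ?t = "\<lambda>c \<xi> n. c (a * x + b * of_int k - of_int n * s) n * \<xi> (x - of_int n * e) (k - n * \<rho>)"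
  have "nabla2 \<beta> \<gamma> (twisted_conv a b s e \<rho> c \<xi>) x k
      = (\<Sum>\<^sub>\<infinity>n. (\<beta> * of_real x + \<gamma> * of_int k) * ?t c \<xi> n)"
    unfolding infsum_cmult_right' by (simp add: nabla2_def twisted_conv_def distrib_right)
  also have "\<dots> = (\<Sum>\<^sub>\<infinity>n. ?t c (nabla2 \<beta> \<gamma> \<xi>) n + ?t (nabla2 0 w c) \<xi> n)"
    by (intro infsum_cong) (simp add: nabla2_def algebra_simps flip: w)
  also have "\<dots> = (\<Sum>\<^sub>\<infinity>n. ?t c (nabla2 \<beta> \<gamma> \<xi>) n) + (\<Sum>\<^sub>\<infinity>n. ?t (nabla2 0 w c) \<xi> n)"
    by (intro infsum_add summable_twisted_conv rapid_nabla2 schwartz_RZ_rapid c \<xi>)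
  finally show "nabla2 \<beta> \<gamma> (twisted_conv a b s e \<rho> c \<xi>) x k =
      (twisted_conv a b s e \<rho> c (nabla2 \<beta> \<gamma> \<xi>) + twisted_conv a b s e \<rho> (nabla2 0 w c) \<xi>) x k"
    by (simp add: twisted_conv_def)
qed

section \<open>The curvature and its constant\<close>

lemma curvature:
  assumes "\<xi> \<in> schwartz_RZ"
  shows "nabla1 \<alpha> (nabla2 \<beta> \<gamma> \<xi>) - nabla2 \<beta> \<gamma> (nabla1 \<alpha> \<xi>) = cscale (of_real \<alpha> * \<beta>) \<xi>"
  by (simp only: nabla1_eq partial1_nabla2[OF assms] nabla2_cscale cscale_add cscale_cscale
      add_diff_cancel_right')

text \<open>Linear algebra in \<open>(e, r)\<close> and \<open>(e', r')\<close>: everything is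
  expressed by the determinant of these two vectors.\<close>

lemma curvature_constant:
  fixes h h' l0 l1 m1 e e' \<alpha> :: real and r r' :: int and \<beta> \<gamma> w :: complex
  assumes h: "h > 0" and h': "h' > 0" and l0: "l0 \<noteq> 0"
    and 1: "l0 * e + l1 * of_int r = - h"
    and 2: "l0 * e' + m1 * of_int r' = h'"
    and 3: "l0 * e' + l1 * of_int r' = 0"
    and 4: "l0 * e + m1 * of_int r = 0"
    and \<alpha>: "\<alpha> = 1 / l0"
    and w1: "\<beta> * of_real e + \<gamma> * of_int r = w"
    and w2: "\<beta> * of_real e' + \<gamma> * of_int r' = w"
  shows "h / h' \<in> \<rat>" and "of_real \<alpha> * \<beta> = w * of_real ((h - h') / (h * h'))"
proof -
  have r': "r' \<noteq> 0" using 2 3 l0 h' by auto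
  \<comment> \<open>The two relations with \<open>l1\<close> evaluate the determinant through
    \<open>h\<close>; the two with \<open>m1\<close> evaluate it through \<open>h'\<close> in
    \<open>B\<close>.\<close>
  have A: "h * of_int r' = - l0 * (e * of_int r' - e' * of_int r)"
    using 1 3 by algebra
  have B: "h' * of_int r = - l0 * (e * of_int r' - e' * of_int r)"
  proof -
    have "h' * of_int r = l0 * e' * of_int r + (m1 * of_int r) * of_int r'"
      by (simp add: algebra_simps flip: 2)
    moreover have "m1 * of_int r = - l0 * e" using 4 by simp
    ultimately show ?thesis by (simp add: algebra_simps)
  qed
  have hr: "h * of_int r' = h' * of_int r" using A B by simp
  then have q: "h / h' = of_int r / of_int r'"
    using r' h' by (simp add: field_simps)
  then show "h / h' \<in> \<rat>" by simp
  \<comment> \<open>Cramer's rule: cross-multiplying by \<open>r'\<close> and \<open>r\<close>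
    removes \<open>\<gamma>\<close>.\<close>
  have "\<beta> * (of_real e * of_int r' - of_real e' * of_int r) = w * (of_int r' - of_int r)"
  proof -
    have "(\<beta> * of_real e + \<gamma> * of_int r) * of_int r'
        - (\<beta> * of_real e' + \<gamma> * of_int r') * of_int r = w * of_int r' - w * of_int r"
      by (simp only: w1 w2)
    then show ?thesis by (simp add: algebra_simps)
  qed
  moreover have "of_real l0 * (of_real e * of_int r' - of_real e' * of_int r)
      = - complex_of_real (h * of_int r')"
    unfolding A by simp
  ultimately have "\<beta> * (- complex_of_real (h * of_int r')) = of_real l0 * w * (of_int r' - of_int r)"
    by algebra
  \<comment> \<open>The factor \<open>h'\<close> allows \<open>h' * r\<close> to be traded for
    \<open>h * r'\<close>, after which \<open>r'\<close> is common to all terms and cancels.\<close>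
  then have "of_real h' * (\<beta> * (- complex_of_real (h * of_int r')))
      = of_real h' * (of_real l0 * w * (of_int r' - of_int r))"
    by (rule arg_cong)
  also have "\<dots> = of_real l0 * w * (of_real h' * of_int r' - complex_of_real (h' * of_int r))"
    by (simp add: algebra_simps)
  also have "\<dots> = of_real l0 * w * (of_real h' * of_int r' - of_real h * of_int r')"
    by (simp flip: hr)
  finally have "of_int r' * (of_real (h * h') * \<beta>) = of_int r' * (of_real l0 * w * of_real (h - h'))"
    by (simp add: algebra_simps)
  then have "of_real (h * h') * \<beta> = of_real l0 * w * of_real (h - h')"
    using r' by simp
  then show "of_real \<alpha> * \<beta> = w * of_real ((h - h') / (h * h'))"
    using l0 h h' by (simp add: \<alpha> field_simps)
qed

theorem mainTheorem9:
  fixes h h' l0 l1 m1 \<epsilon> \<epsilon>' \<alpha> :: real and r r' :: int and \<beta> \<gamma> :: complex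
  assumes "h > 0" and "h' > 0" and "l0 \<noteq> 0"
    and "l0 * \<epsilon> + l1 * of_int r = - h"
    and "l0 * \<epsilon>' + m1 * of_int r' = h'"
    and "l0 * \<epsilon>' + l1 * of_int r' = 0"
    and "l0 * \<epsilon> + m1 * of_int r = 0"
    and "\<alpha> = 1 / l0"
    and "\<beta> * of_real \<epsilon> + \<gamma> * of_int r = 2 * of_real pi * \<i>"
    and "\<beta> * of_real \<epsilon>' + \<gamma> * of_int r' = 2 * of_real pi * \<i>"
  shows "bimodule (hmul h) (hmul h')
      (left_act l0 l1 \<epsilon> r) (right_act l0 m1 \<epsilon>' r' h') \<and>
    bimodule_connection (left_act l0 l1 \<epsilon> r) (right_act l0 m1 \<epsilon>' r' h')
      (nabla1 \<alpha>) (nabla2 \<beta> \<gamma>) \<and>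
    (h = h' \<longrightarrow> (\<forall>\<xi>\<in>schwartz_RZ.
       nabla1 \<alpha> (nabla2 \<beta> \<gamma> \<xi>) - nabla2 \<beta> \<gamma> (nabla1 \<alpha> \<xi>) = 0)) \<and>
    (h \<noteq> h' \<longrightarrow> h / h' \<in> \<rat> \<and> (\<forall>\<xi>\<in>schwartz_RZ.
       nabla1 \<alpha> (nabla2 \<beta> \<gamma> \<xi>) - nabla2 \<beta> \<gamma> (nabla1 \<alpha> \<xi>)
         = cscale (2 * of_real pi * \<i> * of_real ((h - h') / (h * h'))) \<xi>))"
proof (intro conjI)
  note act = left_act_eq right_act_eq
  note RZ = fourier_schwartz_RZ
  show "bimodule (hmul h) (hmul h') (left_act l0 l1 \<epsilon> r) (right_act l0 m1 \<epsilon>' r' h')"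
    unfolding bimodule_def act
  proof (intro conjI ballI allI)
    \<comment> \<open>The relations with right-hand sides \<open>- h\<close> and \<open>h'\<close>
      give associativity on the left and on the right; the two vanishing ones make the actions
      commute.\<close>
    fix f g \<xi> assume f: "f \<in> schwartz_cyl" and g: "g \<in> schwartz_cyl" and \<xi>: "\<xi> \<in> schwartz_RZ"
    show "twisted_conv l0 l1 0 \<epsilon> r (fourier (hmul h f g)) \<xi>
        = twisted_conv l0 l1 0 \<epsilon> r (fourier f) (twisted_conv l0 l1 0 \<epsilon> r (fourier g) \<xi>)"
      unfolding fourier_hmul[OF f g] by (rule twisted_conv_assoc_left[OF RZ[OF f] RZ[OF g] \<xi> assms(4)])
    show "twisted_conv l0 m1 h' \<epsilon>' r' (fourier (hmul h' f g)) \<xi>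
        = twisted_conv l0 m1 h' \<epsilon>' r' (fourier g) (twisted_conv l0 m1 h' \<epsilon>' r' (fourier f) \<xi>)"
      unfolding fourier_hmul[OF f g] by (rule twisted_conv_assoc_right[OF RZ[OF f] RZ[OF g] \<xi> assms(5)])
    show "twisted_conv l0 m1 h' \<epsilon>' r' (fourier g) (twisted_conv l0 l1 0 \<epsilon> r (fourier f) \<xi>)
        = twisted_conv l0 l1 0 \<epsilon> r (fourier f) (twisted_conv l0 m1 h' \<epsilon>' r' (fourier g) \<xi>)"
      by (rule twisted_conv_commute[OF RZ[OF f] RZ[OF g] \<xi> assms(6,7)])
  qed (simp_all only: linear_endo_twisted_conv RZ fourier_add twisted_conv_add_left
      fourier_cscale twisted_conv_cscale_left)
  \<comment> \<open>Both actions evaluate coefficients with the same slope \<open>l0\<close> in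
    \<open>x\<close>, so one \<open>\<alpha>\<close> serves both Leibniz rules of
    \<open>nabla1\<close>. For \<open>nabla2\<close> the relation with \<open>\<epsilon>\<close>
    serves the left action and the one with \<open>\<epsilon>'\<close> the right.\<close>
  have "\<alpha> * l0 = 1" using assms by simp
  then show "bimodule_connection (left_act l0 l1 \<epsilon> r) (right_act l0 m1 \<epsilon>' r' h')
      (nabla1 \<alpha>) (nabla2 \<beta> \<gamma>)"
    unfolding bimodule_connection_def act
    by (auto simp only: linear_endo_nabla1 linear_endo_nabla2 fourier_deriv1 fourier_deriv2 RZ
        nabla1_twisted_conv nabla2_twisted_conv[OF _ _ assms(9)] nabla2_twisted_conv[OF _ _ assms(10)])
  note C = curvature_constant[OF assms]
  show "h = h' \<longrightarrow> (\<forall>\<xi>\<in>schwartz_RZ.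
      nabla1 \<alpha> (nabla2 \<beta> \<gamma> \<xi>) - nabla2 \<beta> \<gamma> (nabla1 \<alpha> \<xi>) = 0)"
    by (auto simp: curvature C(2) cscale_def zero_fun_def)
  show "h \<noteq> h' \<longrightarrow> h / h' \<in> \<rat> \<and> (\<forall>\<xi>\<in>schwartz_RZ.
      nabla1 \<alpha> (nabla2 \<beta> \<gamma> \<xi>) - nabla2 \<beta> \<gamma> (nabla1 \<alpha> \<xi>)
        = cscale (2 * of_real pi * \<i> * of_real ((h - h') / (h * h'))) \<xi>)"
    by (auto simp only: curvature C)
qed

end
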